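(* Let $H$ be a Dedekind-finite, non-torsion monoid. Then: (i) $\mathscr L(\mathcal P_{\rm fin}(H)) \supseteq \mathscr L(\mathcal P_{{\rm fin},\times}(H)) \supseteq \mathscr L(\mathcal P_{{\rm fin},0}(\mathbf N))$. (ii) $\mathscr U_k(\mathcal P_{\rm fin}(H)) = \mathscr U_k(\mathcal P_{{\rm fin},\times}(H)) = \mathscr U_k(\mathcal P_{{\rm fin},0}(\mathbf N)) = \mathbf N_{\ge2}$ for every integer $k\ge2$. (iii) $\Delta(\mathcal P_{\rm fin}(H)) = \Delta(\mathcal P_{{\rm fin},\times}(H)) = \Delta(\mathcal P_{{\rm fin},0}(\mathbf N)) = \mathbf N^+$. (iv) ${\sf Ca}(\mathcal P_{\rm fin}(H)) \supseteq {\sf Ca}(\mathcal P_{{\rm fin},\times}(H)) \supseteq {\sf Ca}(\mathcal P_{{\rm fin},0}(\mathbf N)) = \mathbf N^+$. In particular, if $H$ is a linearly orderable BF-monoid, then the inclusions in (iv) are equalities.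
   Context: Monoids are written multiplicatively (unless stated otherwise) and need not be commutative or cancellative; for a monoid $M$, $M^\times$ is its set of units; $\mathbf N$ (resp. $\mathbf N^+$) is the set of non-negative (resp. positive) integers, $\mathbf N_{\ge 2}$ the set of integers $\ge2$; $\inf\emptyset:=\infty$. $H$ is Dedekind-finite if $xy=1_H$ implies $yx=1_H$; non-torsion if for some $x\in H$ the set $\{x^n:n\in\mathbf N^+\}$ is infinite; linearly orderable if there is a total order $\preceq$ on $H$ such that $xz\prec yz$ and $zx\prec zy$ whenever $x\prec y$. $\mathcal P_{\rm fin}(H)$ is the monoid of all non-empty finite subsets of $H$ with $XY := \{xy: x\in X,y\in Y\}$ and identity $\{1_H\}$; $\mathcal P_{{\rm fin},\times}(H)$ is its submonoid of those $X$ with $X\cap H^\times\neq\emptyset$. $\mathcal P_{{\rm fin},0}(\mathbf N)$ is the restricted power monoid of $(\mathbf N,+)$, i.e. the set of finite subsets of $\mathbf N$ containing $0$, under $X+Y=\{x+y: x\in X, y\in Y\}$. Now let $M$ be any monoid. An atom of $M$ is an element $a\notin M^\times$ such that there are no $x,y\in M\setminus M^\times$ with $a=xy$; $\mathscr A(M)$ is the set of atoms. $\mathsf L_M(1_M):=\{0\}$, and for $x\ne1_M$, $\mathsf L_M(x)$ is the set of $k\in\mathbf N^+$ such that $x$ is a product of $k$ atoms. $M$ is a BF-monoid if $\mathsf L_M(x)$ is non-empty and finite for all $x\in M\setminus M^\times$. $\mathscr L(M):=\{\mathsf L_M(x):x\in M\}\setminus\{\emptyset\}$; $\mathscr U_k(M)$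 is the union of all $L\in\mathscr L(M)$ with $k\in L$. For $L\subseteq\mathbf Z$, $\Delta(L)$ is the set of $d\in\mathbf N^+$ with $L\cap\{l,l+1,\dots,l+d\}=\{l,l+d\}$ for some $l\in L$; $\Delta(M):=\bigcup_{L\in\mathscr L(M)}\Delta(L)$. Catenary degrees. Let $\mathscr F^\ast(\mathscr A(M))$ be the free monoid of words (operation $\ast$) over $\mathscr A(M)$, $\|\mathfrak a\|_M$ the length of the word $\mathfrak a$, and $\pi_M(a_1\ast\cdots\ast a_n):=a_1\cdots a_n$ (the empty word being sent to $1_M$). $\mathcal Z_M(x):=\{\mathfrak a\in\mathscr F^\ast(\mathscr A(M)):\pi_M(\mathfrak a)=x\}$. $\mathscr A^\ast(M):=\{M^\times aM^\times:a\in\mathscr A(M)\}$, and $\mathsf v_M(\mathfrak z;\mathfrak A)$ is the number of positions of the word $\mathfrak z$ whose letter lies in $\mathfrak A\in\mathscr A^\ast(M)$. Set $\mathfrak a\wedge_M\mathfrak b:=\max(\|\mathfrak a\|_M,\|\mathfrak b\|_M)-\sum_{\mathfrak A\in\mathscr A^\ast(M)}\min(\mathsf v_M(\mathfrak a;\mathfrak A),\mathsf v_M(\mathfrak b;\mathfrak A))$ and $\mathsf d_M(\mathfrak a,\mathfrak b):=\max(\delta_M(\mathfrak a,\mathfrak b),\mathfrak a\wedge_M\mathfrak b)$, where $\delta_M(\mathfrak a,\mathfrak b)=0$ if $\pi_M(\mathfrak a)=\pi_M(\mathfrak b)$ and $\frac12$ otherwise. $\mathsf c_M(x)$ is the infimum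 of the set of all $d\in\mathbf N$ such that for all $\mathfrak a,\mathfrak b\in\mathcal Z_M(x)$ there are $\mathfrak c_0,\dots,\mathfrak c_n\in\mathcal Z_M(x)$ with $\mathfrak c_0=\mathfrak a$, $\mathfrak c_n=\mathfrak b$ and $\mathsf d_M(\mathfrak c_{i-1},\mathfrak c_i)\le d$ for $1\le i\le n$. ${\sf Ca}(M):=\{\mathsf c_M(x):x\in M\}\setminus\{0\}\subseteq\mathbf N^+\cup\{\infty\}$. *)

theory Defs
  imports "HOL-Algebra.Coset" "HOL-Algebra.Divisibility" "HOL-Library.Extended_Nat"
begin

section \<open>Conditions on a monoid\<close>

definition dedekind_finite :: "('a, 'b) monoid_scheme \<Rightarrow> bool" where
  "dedekind_finite H \<longleftrightarrow>
    (\<forall>x\<in>carrier H. \<forall>y\<in>carrier H. x \<otimes>\<^bsub>H\<^esub> y = \<one>\<^bsub>H\<^esub> \<longrightarrow> y \<otimes>\<^bsub>H\<^esub> x = \<one>\<^bsub>H\<^esub>)"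

definition non_torsion :: "('a, 'b) monoid_scheme \<Rightarrow> bool" where
  "non_torsion H \<longleftrightarrow> (\<exists>x\<in>carrier H. infinite {x [^]\<^bsub>H\<^esub> n | n::nat. n \<ge> 1})"

definition linearly_orderable :: "('a, 'b) monoid_scheme \<Rightarrow> bool" where
  "linearly_orderable H \<longleftrightarrow>
    (\<exists>r. linear_order_on (carrier H) r \<and>
      (\<forall>x\<in>carrier H. \<forall>y\<in>carrier H. \<forall>z\<in>carrier H. (x, y) \<in> r - Id \<longrightarrow>
        (x \<otimes>\<^bsub>H\<^esub> z, y \<otimes>\<^bsub>H\<^esub> z) \<in> r - Id \<and> (z \<otimes>\<^bsub>H\<^esub> x, z \<otimes>\<^bsub>H\<^esub> y) \<in> r - Id))"

section \<open>Power monoids\<close>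

definition P_fin :: "('a, 'b) monoid_scheme \<Rightarrow> 'a set monoid" where
  "P_fin H = \<lparr>carrier = {X. X \<subseteq> carrier H \<and> finite X \<and> X \<noteq> {}},
              mult = (\<lambda>X Y. X <#>\<^bsub>H\<^esub> Y), one = {\<one>\<^bsub>H\<^esub>}\<rparr>"

definition P_fin_units :: "('a, 'b) monoid_scheme \<Rightarrow> 'a set monoid" where
  "P_fin_units H = P_fin H \<lparr>carrier := {X \<in> carrier (P_fin H). X \<inter> Units H \<noteq> {}}\<rparr>"

definition P_fin_one :: "('a, 'b) monoid_scheme \<Rightarrow> 'a set monoid" where
  "P_fin_one H = P_fin H \<lparr>carrier := {X \<in> carrier (P_fin H). \<one>\<^bsub>H\<^esub> \<in> X}\<rparr>"

definition nat_add_monoid :: "nat monoid" where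
  "nat_add_monoid = \<lparr>carrier = UNIV, mult = (+), one = 0\<rparr>"

abbreviation P_fin_0_nat :: "nat set monoid" where
  "P_fin_0_nat \<equiv> P_fin_one nat_add_monoid"

section \<open>Factorizations and sets of lengths\<close>

text \<open>The library's \<^const>\<open>Divisibility.irreducible\<close> is stated through one-sided divisibility,
  which is not adequate for noncommutative monoids; atoms are therefore defined directly.\<close>

definition atoms :: "('a, 'b) monoid_scheme \<Rightarrow> 'a set" where
  "atoms M = {a \<in> carrier M - Units M.
     \<not> (\<exists>x\<in>carrier M - Units M. \<exists>y\<in>carrier M - Units M. a = x \<otimes>\<^bsub>M\<^esub> y)}"

definition word_prod :: "('a, 'b) monoid_scheme \<Rightarrow> 'a list \<Rightarrow> 'a" where
  "word_prod M w = foldr (\<lambda>x y. x \<otimes>\<^bsub>M\<^esub> y) w \<one>\<^bsub>M\<^esub>"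

definition factorizations :: "('a, 'b) monoid_scheme \<Rightarrow> 'a \<Rightarrow> 'a list set" where
  "factorizations M x = {w \<in> lists (atoms M). word_prod M w = x}"

definition length_set :: "('a, 'b) monoid_scheme \<Rightarrow> 'a \<Rightarrow> nat set" where
  "length_set M x =
    (if x = \<one>\<^bsub>M\<^esub> then {0} else {k. k \<ge> 1 \<and> (\<exists>w\<in>factorizations M x. length w = k)})"

definition BF_monoid :: "('a, 'b) monoid_scheme \<Rightarrow> bool" where
  "BF_monoid M \<longleftrightarrow> monoid M \<and>
    (\<forall>x\<in>carrier M - Units M. length_set M x \<noteq> {} \<and> finite (length_set M x))"

definition system_of_lengths :: "('a, 'b) monoid_scheme \<Rightarrow> nat set set" where
  "system_of_lengths M = {length_set M x | x. x \<in> carrier M} - {{}}"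

definition union_of_lengths :: "nat \<Rightarrow> ('a, 'b) monoid_scheme \<Rightarrow> nat set" where
  "union_of_lengths k M = \<Union> {L \<in> system_of_lengths M. k \<in> L}"

definition delta_of :: "nat set \<Rightarrow> nat set" where
  "delta_of L = {d. d \<ge> 1 \<and> (\<exists>l\<in>L. L \<inter> {l..l + d} = {l, l + d})}"

definition delta_set :: "('a, 'b) monoid_scheme \<Rightarrow> nat set" where
  "delta_set M = (\<Union>L\<in>system_of_lengths M. delta_of L)"

section \<open>Catenary degrees\<close>

definition atom_classes :: "('a, 'b) monoid_scheme \<Rightarrow> 'a set set" where
  "atom_classes M =
    {{u \<otimes>\<^bsub>M\<^esub> a \<otimes>\<^bsub>M\<^esub> v | u v. u \<in> Units M \<and> v \<in> Units M} | a. a \<in> atoms M}"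

definition val :: "'a list \<Rightarrow> 'a set \<Rightarrow> nat" where
  "val w A = card {i. i < length w \<and> w ! i \<in> A}"

text \<open>\<^const>\<open>sum\<close> over an infinite index set is \<open>0\<close> by convention, so the sum over all classes of
  atoms is restricted to the classes with a nonzero summand. There are only finitely many of
  these, because distinct classes are disjoint and each such class contains a letter of \<open>w\<close>.\<close>

definition word_meet :: "('a, 'b) monoid_scheme \<Rightarrow> 'a list \<Rightarrow> 'a list \<Rightarrow> real" where
  "word_meet M w w' = real (max (length w) (length w')) -
     real (\<Sum>A\<in>{A \<in> atom_classes M. min (val w A) (val w' A) \<noteq> 0}. min (val w A) (val w' A))"

definition word_dist :: "('a, 'b) monoid_scheme \<Rightarrow> 'a list \<Rightarrow> 'a list \<Rightarrow> real" where
  "word_dist M w w' =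
    max (if word_prod M w = word_prod M w' then 0 else 1 / 2) (word_meet M w w')"

definition catenary_degree :: "('a, 'b) monoid_scheme \<Rightarrow> 'a \<Rightarrow> enat" where
  "catenary_degree M x = Inf {enat d | d.
     \<forall>w\<in>factorizations M x. \<forall>w'\<in>factorizations M x.
       \<exists>(n::nat) c. c 0 = w \<and> c n = w' \<and> (\<forall>i\<le>n. c i \<in> factorizations M x) \<and>
         (\<forall>i\<in>{1..n}. word_dist M (c (i - 1)) (c i) \<le> real d)}"

definition catenary_set :: "('a, 'b) monoid_scheme \<Rightarrow> enat set" where
  "catenary_set M = {catenary_degree M x | x. x \<in> carrier M} - {0}"

end

theory Submission
  imports Defs "HOL-Library.Set_Algebras"
begin

text \<open>If \<open>H\<close> is Dedekind-finite, the elements of \<open>P_fin H\<close> that meet the units form a divisor-closed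
  submonoid, so all arithmetic invariants restrict. If \<open>x\<close> has infinite order, then
  \<open>X \<mapsto> {x\<^sup>n | n \<in> X}\<close> embeds the finite sets of naturals containing \<open>0\<close>, and every factorization of
  an image in \<open>P_fin_units H\<close> arises letter by letter from a factorization in \<open>P_fin_0_nat\<close>, up to
  units. This yields everything about lengths. For catenary degrees it is not enough: distinct atoms
  may become associated (conjugation may invert \<open>x\<close>, or map it to \<open>x\<^sup>2\<close>), so catenary degrees
  are only determined for suitable sets \<open>X\<close>.

  Let \<open>K\<close> be a set of even numbers with least element \<open>0\<close> and greatest element \<open>2z\<close>, where \<open>z\<close> is
  odd, and suppose that all factorizations of \<open>K\<close> have length \<open>m\<close>. Under a mild cancellation
  condition, \<open>X = K + {0, z}\<close> has, apart from the factorizations \<open>{0, z} + (factorization of K)\<close> of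
  length \<open>m + 1\<close>, only the factorization \<open>{0, z} + (K \<union> {z})\<close> of length \<open>2\<close>. Two factorizations
  always share \<open>{0, z}\<close>, and \<open>K \<union> {z}\<close> has more elements than all letters of the longer
  factorizations, so the catenary degree of \<open>X\<close> is \<open>m\<close> and remains so after embedding. For \<open>m = 1\<close>
  take \<open>K = {0, 2, 6}\<close>, for \<open>m \<ge> 2\<close> the cube \<open>{0, 2} + {0, 8} + \<dots> + {0, 2 * 4\<^sup>m\<^sup>-\<^sup>1}\<close>.

  If \<open>H\<close> is a linearly ordered BF-monoid, the number of letters with at least two elements in a
  factorization of \<open>X\<close> is less than \<open>card X\<close>, and the number of singleton letters is bounded by the
  lengths of the elements of \<open>X\<close> in \<open>H\<close>; hence catenary degrees in \<open>P_fin H\<close> are finite.\<close>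

section \<open>Dedekind-finite monoids\<close>

lemma word_prod_Nil [simp]: "word_prod M [] = \<one>\<^bsub>M\<^esub>"
  by (simp add: word_prod_def)

lemma word_prod_Cons [simp]: "word_prod M (a # w) = a \<otimes>\<^bsub>M\<^esub> word_prod M w"
  by (simp add: word_prod_def)

lemma (in monoid) word_prod_closed: "set w \<subseteq> carrier G \<Longrightarrow> word_prod G w \<in> carrier G"
  by (induction w) auto

lemma atoms_closed: "a \<in> atoms M \<Longrightarrow> a \<in> carrier M"
  by (simp add: atoms_def)

lemma atom_not_unit: "a \<in> atoms M \<Longrightarrow> a \<notin> Units M"
  by (simp add: atoms_def)

lemma atomD:
  "\<lbrakk>x \<otimes>\<^bsub>M\<^esub> y \<in> atoms M; x \<in> carrier M; y \<in> carrier M\<rbrakk> \<Longrightarrow> x \<in> Units M \<or> y \<in> Units M"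
  by (auto simp: atoms_def)

lemma atoms_subset_carrier: "atoms M \<subseteq> carrier M"
  by (auto simp: atoms_def)

locale df_monoid = monoid +
  assumes dedekind_finite: "dedekind_finite G"
begin

lemma one_commute: "\<lbrakk>x \<in> carrier G; y \<in> carrier G; x \<otimes> y = \<one>\<rbrakk> \<Longrightarrow> y \<otimes> x = \<one>"
  using dedekind_finite by (auto simp: dedekind_finite_def)

lemma mult_one_Units:
  assumes "x \<in> carrier G" "y \<in> carrier G" "x \<otimes> y = \<one>"
  shows "x \<in> Units G" "y \<in> Units G"
  using assms one_commute[OF assms] by (auto simp: Units_def)

text \<open>If \<open>c\<close> inverts \<open>x \<otimes> y\<close>, then
  \<open>y \<otimes> c\<close> is a right inverse of \<open>x\<close> and
  \<open>c \<otimes> x\<close> a left inverse of \<open>y\<close>; Dedekind-finiteness makes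
  one-sided inverses two-sided.\<close>

lemma Units_multD:
  assumes "x \<otimes> y \<in> Units G" "x \<in> carrier G" "y \<in> carrier G"
  shows "x \<in> Units G" "y \<in> Units G"
proof -
  obtain c where c: "c \<in> carrier G" "(x \<otimes> y) \<otimes> c = \<one>" "c \<otimes> (x \<otimes> y) = \<one>"
    using assms by (auto simp: Units_def)
  have "x \<otimes> (y \<otimes> c) = \<one>" using c assms by (simp add: m_assoc)
  then show "x \<in> Units G" using mult_one_Units(1) c assms by blast
  have "(c \<otimes> x) \<otimes> y = \<one>" using c assms by (simp add: m_assoc)
  then show "y \<in> Units G" using mult_one_Units(2) c assms by blast
qed

lemma Units_mult_iff:
  "\<lbrakk>x \<in> carrier G; y \<in> carrier G\<rbrakk> \<Longrightarrow> x \<otimes> y \<in> Units G \<longleftrightarrow> x \<in> Units G \<and> y \<in> Units G"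
  using Units_multD Units_m_closed by blast

lemma word_prod_atoms_Units:
  assumes "set w \<subseteq> atoms G" "word_prod G w \<in> Units G"
  shows "w = []"
proof (cases w)
  case (Cons a w')
  then have "a \<in> Units G"
    using assms Units_multD(1)[of a "word_prod G w'"] word_prod_closed[of w'] atoms_subset_carrier[of G]
    by auto
  then show ?thesis using Cons assms atom_not_unit[of a] by auto
qed auto

text \<open>The first letter is a nonunit, so the product of the remaining letters is a unit, and a
  word of atoms has a unit as product only if it is empty.\<close>

lemma factorization_of_atom:
  assumes "set w \<subseteq> atoms G" "word_prod G w \<in> atoms G"
  shows "w = [word_prod G w]"
proof (cases w)
  case Nil
  then show ?thesis using assms by (auto simp: atoms_def)
next
  case (Cons a w')
  then have car: "a \<in> carrier G" "word_prod G w' \<in> carrier G"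
    using assms atoms_subset_carrier[of G] word_prod_closed[of w'] by auto
  then have "a \<in> Units G \<or> word_prod G w' \<in> Units G"
    using assms Cons atomD[of G a "word_prod G w'"] by auto
  then have "w' = []" using assms Cons atom_not_unit[of a] word_prod_atoms_Units[of w'] by auto
  then show ?thesis using Cons car by simp
qed

text \<open>A length \<open>1\<close> would make \<open>x\<close> an atom, whose only factorization
  is too short for the length \<open>k \<ge> 2\<close>.\<close>

lemma union_of_lengths_subset:
  assumes "k \<ge> 2"
  shows "union_of_lengths k G \<subseteq> {2..}"
proof
  fix l assume "l \<in> union_of_lengths k G"
  then obtain x where x: "k \<in> length_set G x" "l \<in> length_set G x"
    by (auto simp: union_of_lengths_def system_of_lengths_def)
  have "x \<noteq> \<one>" using x assms by (auto simp: length_set_def)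
  then obtain w w' where w: "w \<in> factorizations G x" "length w = k"
    "w' \<in> factorizations G x" "length w' = l" "l \<ge> 1"
    using x by (auto simp: length_set_def)
  have "l \<noteq> 1"
  proof
    assume "l = 1"
    then obtain a where "w' = [a]" using w by (auto simp: length_Suc_conv)
    then have "x \<in> atoms G" using w atoms_closed[of a G] by (auto simp: factorizations_def)
    then have "w = [x]" using factorization_of_atom[of w] w by (auto simp: factorizations_def)
    then show False using w assms by simp
  qed
  then show "l \<in> {2..}" using w by auto
qed

end

section \<open>Divisor-closed submonoids\<close>

text \<open>\<open>S_mult_iff\<close> packs two conditions: from right to left closure under
  products, from left to right closure under divisors. The latter makes units, atoms and
  factorizations of elements of \<open>S\<close> the same in \<open>N\<close> and in
  \<open>G\<close>.\<close>

locale divisor_closed_submonoid = df_monoid +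
  fixes S
  assumes S_sub: "S \<subseteq> carrier G" and S_one: "\<one> \<in> S"
    and S_mult_iff: "\<lbrakk>x \<in> carrier G; y \<in> carrier G\<rbrakk> \<Longrightarrow> x \<otimes> y \<in> S \<longleftrightarrow> x \<in> S \<and> y \<in> S"
begin

abbreviation "N \<equiv> G\<lparr>carrier := S\<rparr>"

lemma monoid_sub: "monoid N"
  by (rule monoidI) (use S_sub S_one S_mult_iff in \<open>auto simp: subset_iff m_assoc\<close>)

lemma df_monoid_sub: "df_monoid N"
proof -
  interpret N: monoid N by (rule monoid_sub)
  show ?thesis
  proof
    show "dedekind_finite N"
      unfolding dedekind_finite_def
    proof (intro ballI impI)
      fix x y assume "x \<in> carrier N" "y \<in> carrier N" "x \<otimes>\<^bsub>N\<^esub> y = \<one>\<^bsub>N\<^esub>"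
      then show "y \<otimes>\<^bsub>N\<^esub> x = \<one>\<^bsub>N\<^esub>"
        using one_commute[of x y] S_sub by auto
    qed
  qed
qed

lemma Units_sub: "Units N = Units G"
proof -
  have "x \<in> S" if "x \<in> Units G" for x
    using that S_mult_iff[of x "inv x"] S_one Units_closed by simp
  then show ?thesis using S_sub by (auto simp: Units_def)
qed

lemma atoms_sub: "atoms N = atoms G \<inter> S"
proof -
  have *: "(\<exists>x\<in>S - Units G. \<exists>y\<in>S - Units G. a = x \<otimes> y) \<longleftrightarrow>
      (\<exists>x\<in>carrier G - Units G. \<exists>y\<in>carrier G - Units G. a = x \<otimes> y)" if "a \<in> S" for a
  proof
    assume "\<exists>x\<in>carrier G - Units G. \<exists>y\<in>carrier G - Units G. a = x \<otimes> y"
    then obtain x y where "x \<in> carrier G - Units G" "y \<in> carrier G - Units G" "a = x \<otimes> y"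
      by blast
    then show "\<exists>x\<in>S - Units G. \<exists>y\<in>S - Units G. a = x \<otimes> y"
      using that S_mult_iff[of x y] by blast
  qed (use S_sub in blast)
  have "a \<in> atoms N \<longleftrightarrow> a \<in> atoms G" if "a \<in> S" for a
    using *[OF that] that S_sub by (auto simp: atoms_def Units_sub)
  then show ?thesis using atoms_subset_carrier[of N] by auto
qed

lemma word_prod_sub: "word_prod N w = word_prod G w"
  by (induction w) auto

lemma word_prod_in_S: "set w \<subseteq> carrier G \<Longrightarrow> word_prod G w \<in> S \<longleftrightarrow> set w \<subseteq> S"
  by (induction w) (auto simp: S_one S_mult_iff word_prod_closed)

lemma factorizations_sub:
  assumes "x \<in> S" shows "factorizations N x = factorizations G x"
proof -
  have "w \<in> lists (atoms G \<inter> S)" if "w \<in> lists (atoms G)" "word_prod G w \<in> S" for w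
    using that word_prod_in_S[of w] atoms_subset_carrier[of G] by (auto simp: in_lists_conv_set)
  then show ?thesis using assms by (auto simp: factorizations_def atoms_sub word_prod_sub)
qed

lemma length_set_sub: "x \<in> S \<Longrightarrow> length_set N x = length_set G x"
  by (simp add: length_set_def factorizations_sub)

lemma system_of_lengths_sub: "system_of_lengths N \<subseteq> system_of_lengths G"
  using length_set_sub S_sub by (fastforce simp: system_of_lengths_def)

end

section \<open>Classes of atoms and distances of words\<close>

definition atom_class :: "('a, 'b) monoid_scheme \<Rightarrow> 'a \<Rightarrow> 'a set" where
  "atom_class M a = {u \<otimes>\<^bsub>M\<^esub> a \<otimes>\<^bsub>M\<^esub> v | u v. u \<in> Units M \<and> v \<in> Units M}"

lemma atom_classes_eq: "atom_classes M = atom_class M ` atoms M"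
  by (auto simp: atom_classes_def atom_class_def)

context monoid
begin

lemma atom_class_trans:
  assumes "b \<in> atom_class G a" "a \<in> carrier G"
  shows "atom_class G b \<subseteq> atom_class G a"
proof
  fix c assume "c \<in> atom_class G b"
  then obtain u v s t where *: "u \<in> Units G" "v \<in> Units G" "s \<in> Units G" "t \<in> Units G"
    "b = u \<otimes> a \<otimes> v" "c = s \<otimes> b \<otimes> t"
    using assms by (auto simp: atom_class_def)
  then have "c = (s \<otimes> u) \<otimes> a \<otimes> (v \<otimes> t)"
    using assms by (simp add: m_assoc Units_closed)
  then show "c \<in> atom_class G a" unfolding atom_class_def using * Units_m_closed by blast
qed

lemma atom_class_sym:
  assumes "b \<in> atom_class G a" "a \<in> carrier G"
  shows "a \<in> atom_class G b"
proof -
  obtain u v where *: "u \<in> Units G" "v \<in> Units G" "b = u \<otimes> a \<otimes> v"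
    using assms by (auto simp: atom_class_def)
  have "inv u \<otimes> b \<otimes> inv v = inv u \<otimes> u \<otimes> a \<otimes> (v \<otimes> inv v)"
    using * assms by (simp only: m_assoc Units_closed Units_inv_closed m_closed)
  also have "\<dots> = a" using * assms by simp
  finally show ?thesis unfolding atom_class_def using * Units_inv_Units by blast
qed

lemma atom_class_eq:
  assumes "b \<in> atom_class G a" "a \<in> carrier G"
  shows "atom_class G b = atom_class G a"
proof -
  have "b \<in> carrier G" using assms by (auto simp: atom_class_def)
  then show ?thesis using assms atom_class_trans atom_class_sym by blast
qed

text \<open>Association by units is an equivalence relation, so any member determines its class;
  hence distinct classes are disjoint.\<close>

lemma atom_classes_member:
  assumes "A \<in> atom_classes G" "b \<in> A"
  shows "A = atom_class G b"
  using assms atom_class_eq atoms_closed by (fastforce simp: atom_classes_eq)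

end

definition common_classes :: "('a, 'b) monoid_scheme \<Rightarrow> 'a list \<Rightarrow> 'a list \<Rightarrow> 'a set set" where
  "common_classes M w w' = {A \<in> atom_classes M. min (val w A) (val w' A) \<noteq> 0}"

lemma val_nonzero_iff: "val w A \<noteq> 0 \<longleftrightarrow> (\<exists>b\<in>set w. b \<in> A)"
  by (auto simp: val_def card_eq_0_iff set_conv_nth)

lemma common_classes_eq:
  "common_classes M w w' = {A \<in> atom_classes M. (\<exists>b\<in>set w. b \<in> A) \<and> (\<exists>b\<in>set w'. b \<in> A)}"
  by (auto simp: common_classes_def simp flip: val_nonzero_iff)

lemma word_meet_eq:
  "word_meet M w w' = real (max (length w) (length w')) -
     real (\<Sum>A\<in>common_classes M w w'. min (val w A) (val w' A))"
  by (simp add: word_meet_def common_classes_def)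

lemma word_meet_le_max: "word_meet M w w' \<le> real (max (length w) (length w'))"
  by (simp add: word_meet_eq sum_nonneg)

context monoid
begin

lemma finite_common_classes: "finite (common_classes G w w')"
proof (rule finite_subset)
  show "common_classes G w w' \<subseteq> atom_class G ` set w"
    using atom_classes_member by (auto simp: common_classes_eq)
qed simp

text \<open>The class of \<open>a\<close> alone contributes at least \<open>1\<close> to the
  subtracted sum.\<close>

lemma word_meet_le_common_letter:
  assumes "a \<in> atoms G" "b \<in> set w" "b \<in> atom_class G a" "b' \<in> set w'" "b' \<in> atom_class G a"
  shows "word_meet G w w' \<le> real (max (length w) (length w')) - 1"
proof -
  let ?A = "atom_class G a"
  have A: "?A \<in> common_classes G w w'"
    using assms by (auto simp: common_classes_eq atom_classes_eq)
  then have "1 \<le> min (val w ?A) (val w' ?A)"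
    by (auto simp: common_classes_def)
  also have "\<dots> \<le> (\<Sum>A\<in>common_classes G w w'. min (val w A) (val w' A))"
    by (rule member_le_sum[OF A _ finite_common_classes]) simp
  finally show ?thesis unfolding word_meet_eq by linarith
qed

text \<open>The sets of positions of \<open>w\<close> belonging to the common classes are pairwise
  disjoint and miss the position of \<open>b\<close>, so at most \<open>length w - 1\<close> is
  subtracted.\<close>

lemma word_meet_ge_isolated_letter:
  assumes "\<And>A. A \<in> common_classes G w w' \<Longrightarrow> b \<notin> A" and "b \<in> set w"
  shows "word_meet G w w' \<ge> real (max (length w) (length w')) - real (length w - 1)"
proof -
  let ?I = "\<lambda>A. {i. i < length w \<and> w ! i \<in> A}"
  obtain j where j: "j < length w" "w ! j = b" using assms(2) by (auto simp: in_set_conv_nth)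
  have "(\<Sum>A\<in>common_classes G w w'. min (val w A) (val w' A)) \<le>
      (\<Sum>A\<in>common_classes G w w'. card (?I A))"
    by (rule sum_mono) (simp add: val_def)
  also have "\<dots> = card (\<Union>A\<in>common_classes G w w'. ?I A)"
  proof (rule card_UN_disjoint[symmetric, OF finite_common_classes])
    show "\<forall>A\<in>common_classes G w w'. \<forall>B\<in>common_classes G w w'. A \<noteq> B \<longrightarrow> ?I A \<inter> ?I B = {}"
      using atom_classes_member unfolding common_classes_def by blast
  qed auto
  also have "\<dots> \<le> card ({..<length w} - {j})"
    by (rule card_mono) (use assms(1) j in auto)
  also have "\<dots> = length w - 1" using j by simp
  finally show ?thesis unfolding word_meet_eq by linarith
qed

end

context divisor_closed_submonoid
begin

lemma atom_class_sub: "atom_class N a = atom_class G a"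
  by (simp add: atom_class_def Units_sub)

text \<open>It suffices to control one of the two words: a common class contains a letter of
  \<open>w\<close>, hence is the class of an atom of \<open>N\<close>.\<close>

lemma common_classes_sub:
  assumes "set w \<subseteq> atoms N"
  shows "common_classes N w w' = common_classes G w w'"
proof -
  have "A \<in> atom_classes G \<longleftrightarrow> A \<in> atom_classes N" if "b \<in> set w" "b \<in> A" for A b
  proof
    assume "A \<in> atom_classes G"
    then have "A = atom_class N b" using that atom_classes_member by (auto simp: atom_class_sub)
    then show "A \<in> atom_classes N" using that assms by (auto simp: atom_classes_eq)
  next
    assume "A \<in> atom_classes N"
    then show "A \<in> atom_classes G" by (auto simp: atom_classes_eq atom_class_sub atoms_sub)
  qed
  then show ?thesis by (auto simp: common_classes_eq)
qed

lemma word_dist_sub: "set w \<subseteq> atoms N \<Longrightarrow> word_dist N w w' = word_dist G w w'"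
  by (simp add: word_dist_def word_meet_eq word_prod_sub common_classes_sub)

lemma catenary_degree_sub:
  assumes "x \<in> S"
  shows "catenary_degree N x = catenary_degree G x"
proof -
  have F: "factorizations N x = factorizations G x"
    by (rule factorizations_sub[OF assms])
  have D: "word_dist N (c (i - 1)) (c i) = word_dist G (c (i - 1)) (c i)"
    if "\<forall>i\<le>n. c i \<in> factorizations G x" "i \<in> {1..n}" for c :: "nat \<Rightarrow> _" and i n
  proof (rule word_dist_sub)
    have "c (i - 1) \<in> factorizations N x" using that F by (metis atLeastAtMost_iff diff_le_self le_trans)
    then show "set (c (i - 1)) \<subseteq> atoms N" by (auto simp: factorizations_def)
  qed
  have "(\<exists>(n::nat) c. c 0 = w \<and> c n = w' \<and> (\<forall>i\<le>n. c i \<in> factorizations G x) \<and>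
         (\<forall>i\<in>{1..n}. word_dist N (c (i - 1)) (c i) \<le> real d)) \<longleftrightarrow>
        (\<exists>(n::nat) c. c 0 = w \<and> c n = w' \<and> (\<forall>i\<le>n. c i \<in> factorizations G x) \<and>
         (\<forall>i\<in>{1..n}. word_dist G (c (i - 1)) (c i) \<le> real d))" for w w' d
    by (intro ex_cong1 conj_cong refl ball_cong) (simp only: D)
  then show ?thesis unfolding catenary_degree_def F by simp
qed

lemma catenary_set_sub: "catenary_set N \<subseteq> catenary_set G"
  using catenary_degree_sub S_sub by (fastforce simp: catenary_set_def)

end

section \<open>Bounds for catenary degrees\<close>

text \<open>The chain consisting of \<open>w\<close> and \<open>w'\<close> alone already works,
  because the term for different products vanishes between factorizations of the same
  element.\<close>

lemma catenary_degree_le: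
  assumes "\<And>w w'. \<lbrakk>w \<in> factorizations M x; w' \<in> factorizations M x\<rbrakk> \<Longrightarrow> word_meet M w w' \<le> real d"
  shows "catenary_degree M x \<le> enat d"
proof -
  have "\<exists>(n::nat) c. c 0 = w \<and> c n = w' \<and> (\<forall>i\<le>n. c i \<in> factorizations M x) \<and>
         (\<forall>i\<in>{1..n}. word_dist M (c (i - 1)) (c i) \<le> real d)"
    if w: "w \<in> factorizations M x" "w' \<in> factorizations M x" for w w'
  proof (intro exI[of _ 1] exI[of _ "\<lambda>i::nat. if i = 0 then w else w'"] conjI)
    show "\<forall>i\<in>{1..1::nat}. word_dist M (if i - 1 = 0 then w else w') (if i = 0 then w else w') \<le> real d"
    proof
      fix i :: nat assume "i \<in> {1..1::nat}"
      then have "i = 1" by simp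
      then show "word_dist M (if i - 1 = 0 then w else w') (if i = 0 then w else w') \<le> real d"
        using w assms[OF w] by (auto simp: word_dist_def factorizations_def)
    qed
  qed (use w in auto)
  then show ?thesis unfolding catenary_degree_def by (intro Inf_lower) auto
qed

text \<open>A chain from a factorization with \<open>P\<close> to one without must lose
  \<open>P\<close> at some single step, and this step has distance at least
  \<open>d\<close>.\<close>

lemma catenary_degree_ge:
  assumes "\<And>v v'. \<lbrakk>v \<in> factorizations M x; v' \<in> factorizations M x; P v; \<not> P v'\<rbrakk> \<Longrightarrow> word_meet M v v' \<ge> real d"
    and w: "w \<in> factorizations M x" "P w" and w': "w' \<in> factorizations M x" "\<not> P w'"
  shows "catenary_degree M x \<ge> enat d"
  unfolding catenary_degree_def
proof (rule Inf_greatest)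
  fix e assume "e \<in> {enat d | d.
     \<forall>w\<in>factorizations M x. \<forall>w'\<in>factorizations M x.
       \<exists>(n::nat) c. c 0 = w \<and> c n = w' \<and> (\<forall>i\<le>n. c i \<in> factorizations M x) \<and>
         (\<forall>i\<in>{1..n}. word_dist M (c (i - 1)) (c i) \<le> real d)}"
  then obtain k n and c :: "nat \<Rightarrow> _" where k: "e = enat k" and c: "c 0 = w" "c n = w'"
    "\<forall>i\<le>n. c i \<in> factorizations M x" "\<forall>i\<in>{1..n}. word_dist M (c (i - 1)) (c i) \<le> real k"
    using w w' by blast
  have "\<exists>i<n. P (c i) \<and> \<not> P (c (Suc i))"
  proof (rule ccontr)
    assume *: "\<not> (\<exists>i<n. P (c i) \<and> \<not> P (c (Suc i)))"
    have "P (c i)" if "i \<le> n" for i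
      using that by (induction i) (use * c w in auto)
    then show False using c w' by auto
  qed
  then obtain i where i: "i < n" "P (c i)" "\<not> P (c (Suc i))" by blast
  then have "real d \<le> word_meet M (c i) (c (Suc i))"
    using assms(1) c by (meson Suc_leI less_imp_le)
  also have "\<dots> \<le> word_dist M (c i) (c (Suc i))" by (simp add: word_dist_def)
  also have "\<dots> \<le> real k" using c(4)[rule_format, of "Suc i"] i by simp
  finally show "enat d \<le> e" using k by simp
qed

text \<open>Distances of factorizations never exceed the larger length, so bounded lengths exclude
  the value \<open>\<infinity>\<close>; the value \<open>0\<close> is removed by definition.\<close>

lemma catenary_set_subset_of_bounded_lengths:
  assumes "\<And>x. x \<in> carrier M \<Longrightarrow> \<exists>b. \<forall>w\<in>factorizations M x. length w \<le> b"
  shows "catenary_set M \<subseteq> enat ` {1..}"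
proof
  fix e assume "e \<in> catenary_set M"
  then obtain x where x: "x \<in> carrier M" "e = catenary_degree M x" "e \<noteq> 0"
    by (auto simp: catenary_set_def)
  obtain b where b: "\<And>w. w \<in> factorizations M x \<Longrightarrow> length w \<le> b" using assms[OF x(1)] by blast
  have "e \<le> enat b"
    unfolding x(2)
  proof (rule catenary_degree_le)
    fix w w' assume "w \<in> factorizations M x" "w' \<in> factorizations M x"
    then have "real (max (length w) (length w')) \<le> real b" using b by simp
    then show "word_meet M w w' \<le> real b" using word_meet_le_max[of M w w'] by linarith
  qed
  then obtain d where d: "e = enat d" by (cases e) auto
  then have "d \<noteq> 0" using x(3) by (auto simp: zero_enat_def)
  then show "e \<in> enat ` {1..}" using d by auto
qed

section \<open>Sumsets of natural numbers\<close>

lemma carrier_P_fin_0_nat: "carrier P_fin_0_nat = {A. finite A \<and> 0 \<in> A}"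
  by (auto simp: P_fin_one_def P_fin_def nat_add_monoid_def)

lemma mult_P_fin_0_nat: "mult P_fin_0_nat = (+)"
  by (auto simp: P_fin_one_def P_fin_def nat_add_monoid_def set_mult_def set_plus_def fun_eq_iff)

lemma one_P_fin_0_nat: "one P_fin_0_nat = {0}"
  by (simp add: P_fin_one_def P_fin_def nat_add_monoid_def)

lemmas P_fin_0_nat_simps = carrier_P_fin_0_nat mult_P_fin_0_nat one_P_fin_0_nat

lemma zero_in_sumset: "\<lbrakk>0 \<in> A; 0 \<in> B\<rbrakk> \<Longrightarrow> (0::nat) \<in> A + B"
  using set_plus_intro[of 0 A 0 B] by simp

lemma sumset_left_subset: "0 \<in> B \<Longrightarrow> A \<subseteq> A + (B::nat set)"
  using set_zero_plus2[of B A] by (simp add: add.commute)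

lemma sumset_right_subset: "0 \<in> A \<Longrightarrow> B \<subseteq> A + (B::nat set)"
  by (rule set_zero_plus2)

lemma sumset_pair: "A + {0, n} = A \<union> (\<lambda>a. a + n) ` (A::nat set)"
  by (auto simp: set_plus_def)

lemma sumset_eq_zero_iff:
  assumes "0 \<in> A" "0 \<in> B"
  shows "A + B = {0} \<longleftrightarrow> A = {0} \<and> B = {0::nat}"
  using assms sumset_left_subset[of B A] sumset_right_subset[of A B] by auto

lemma df_monoid_P_fin_0_nat: "df_monoid P_fin_0_nat"
proof -
  have "monoid P_fin_0_nat"
    by (rule monoidI) (auto simp: P_fin_0_nat_simps finite_set_plus zero_in_sumset add.assoc)
  then show ?thesis
    by (auto simp: df_monoid_def df_monoid_axioms_def dedekind_finite_def P_fin_0_nat_simps add.commute)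
qed

interpretation nat_sets: df_monoid P_fin_0_nat
  by (rule df_monoid_P_fin_0_nat)

lemma Units_P_fin_0_nat: "Units P_fin_0_nat = {{0}}"
  using sumset_eq_zero_iff by (auto simp: Units_def P_fin_0_nat_simps intro!: exI[of _ "{0}"])

text \<open>Summands containing \<open>0\<close> are subsets of their sum, so \<open>B\<close> and
  \<open>C\<close> inherit finiteness from \<open>A\<close>.\<close>

lemma atoms_P_fin_0_nat_iff:
  "A \<in> atoms P_fin_0_nat \<longleftrightarrow> finite A \<and> 0 \<in> A \<and> A \<noteq> {0} \<and>
     (\<forall>B C. 0 \<in> B \<longrightarrow> 0 \<in> C \<longrightarrow> A = B + C \<longrightarrow> B = {0} \<or> C = {0})"
proof -
  have fin: "finite B \<and> finite C" if "finite (B + C)" "0 \<in> B" "0 \<in> C" for B C :: "nat set"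
    using that sumset_left_subset[of C B] sumset_right_subset[of B C] finite_subset by blast
  show ?thesis
    unfolding atoms_def Units_P_fin_0_nat P_fin_0_nat_simps using fin by blast
qed

lemma word_prod_P_fin_0_nat: "word_prod P_fin_0_nat w = sum_list w"
  by (induction w) (simp_all add: P_fin_0_nat_simps set_zero)

lemma factorizations_P_fin_0_nat_iff:
  "w \<in> factorizations P_fin_0_nat A \<longleftrightarrow> set w \<subseteq> atoms P_fin_0_nat \<and> sum_list w = A"
  by (auto simp: factorizations_def word_prod_P_fin_0_nat)

lemma zero_in_sum_list: "\<forall>A\<in>set w. (0::nat) \<in> A \<Longrightarrow> 0 \<in> sum_list w"
  by (induction w) (auto simp: set_zero zero_in_sumset)

lemma zero_in_sum_list_atoms: "set w \<subseteq> atoms P_fin_0_nat \<Longrightarrow> 0 \<in> sum_list w"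
  by (rule zero_in_sum_list) (auto simp: atoms_P_fin_0_nat_iff)

lemma sum_list_remove1: "A \<in> set w \<Longrightarrow> sum_list w = A + sum_list (remove1 A w)"
  for w :: "nat set list"
  by (rule sum_list_map_remove1[of _ _ "\<lambda>x. x", simplified])

lemma length_remove1_mem: "x \<in> set w \<Longrightarrow> length w = Suc (length (remove1 x w))"
  using length_pos_if_in_set[of x w] by (simp add: length_remove1)

lemma subset_sum_list:
  assumes "\<forall>A\<in>set w. (0::nat) \<in> A" "A \<in> set w"
  shows "A \<subseteq> sum_list w"
proof -
  have "sum_list w = A + sum_list (remove1 A w)"
    by (rule sum_list_remove1[OF assms(2)])
  moreover have "0 \<in> sum_list (remove1 A w)"
    using assms set_remove1_subset[of A w] by (intro zero_in_sum_list) blast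
  ultimately show ?thesis using sumset_left_subset[of "sum_list (remove1 A w)" A] by simp
qed

text \<open>If both summands were nontrivial, both would contain \<open>n\<close>, and
  \<open>n + n\<close> would lie in the sum.\<close>

lemma pair_atom:
  assumes "n > 0" shows "{0, n} \<in> atoms P_fin_0_nat"
proof -
  have "B = {0} \<or> C = {0}" if *: "0 \<in> B" "0 \<in> C" "{0, n} = B + C" for B C
  proof (rule ccontr)
    assume "\<not> ?thesis"
    moreover have "B \<subseteq> {0, n}" "C \<subseteq> {0, n}"
      using * sumset_left_subset[of C B] sumset_right_subset[of B C] by auto
    ultimately have "n \<in> B" "n \<in> C" using *(1,2) by blast+
    then have "n + n \<in> {0, n}" using *(3) by blast
    then show False using assms by auto
  qed
  then show ?thesis using assms by (auto simp: atoms_P_fin_0_nat_iff)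
qed

text \<open>Cancellation is only required among sets containing \<open>0\<close> whose sum is \<open>K\<close>; sumsets of
  natural numbers are not cancellative in general.\<close>

definition cancellable_decompositions :: "nat set \<Rightarrow> bool" where
  "cancellable_decompositions K \<longleftrightarrow>
    (\<forall>E D F. 0 \<in> E \<longrightarrow> 0 \<in> D \<longrightarrow> 0 \<in> F \<longrightarrow> E + F = K \<longrightarrow> D + F = K \<longrightarrow> E = D)"

lemma cancellable_decompositionsD:
  "\<lbrakk>cancellable_decompositions K; E + F = K; D + F = K; 0 \<in> E; 0 \<in> D; 0 \<in> F\<rbrakk> \<Longrightarrow> E = D"
  by (auto simp: cancellable_decompositions_def)

lemma atom_cancellable_decompositions:
  assumes "K \<in> atoms P_fin_0_nat"
  shows "cancellable_decompositions K"
  unfolding cancellable_decompositions_def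
proof (intro allI impI)
  fix E D F :: "nat set" assume *: "0 \<in> E" "0 \<in> D" "0 \<in> F" "E + F = K" "D + F = K"
  show "E = D"
  proof (cases "F = {0}")
    case False
    then have "E = {0}" "D = {0}" using * assms by (auto simp: atoms_P_fin_0_nat_iff)
    then show ?thesis by simp
  qed (use * in simp)
qed

text \<open>In \<open>K + {0, g}\<close> let \<open>P\<close> separate \<open>K\<close> from its translate \<open>K + g\<close> in a way that is additive as
  long as at most one summand satisfies \<open>P\<close>. It is used with \<open>P\<close> meaning large and with
  \<open>P\<close> meaning odd.\<close>

locale separated_translate =
  fixes K :: "nat set" and g :: nat and P :: "nat \<Rightarrow> bool"
  assumes zero_in_K: "0 \<in> K"
    and cancel: "cancellable_decompositions K"
    and not_P: "k \<in> K \<Longrightarrow> \<not> P k"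
    and P_translate: "k \<in> K \<Longrightarrow> P (k + g)"
    and not_P_add: "\<lbrakk>a \<in> K; b \<in> K; a + b \<in> K + {0, g}\<rbrakk> \<Longrightarrow> \<not> P (a + b)"
    and P_add: "\<lbrakk>a \<in> K; b \<in> K; (a + g) + b \<in> K + {0, g}\<rbrakk> \<Longrightarrow> P ((a + g) + b)"
begin

lemma mem_iff: "a \<in> K + {0, g} \<longleftrightarrow> a \<in> K \<or> (\<exists>k\<in>K. a = k + g)"
  by (auto simp: sumset_pair)

text \<open>Here \<open>B\<close> lies in \<open>K\<close>, so \<open>P\<close> sorts the elements
  of \<open>A + B\<close> by their summand from \<open>A\<close>: those not satisfying
  \<open>P\<close> give \<open>E + B = K\<close>, those satisfying \<open>P\<close> give
  \<open>D + B = K\<close> after subtracting \<open>g\<close>. Cancellation yields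
  \<open>E = D\<close>, so \<open>{0, g}\<close> splits off from \<open>A\<close>.\<close>

lemma decomposition:
  assumes AB: "A + B = K + {0, g}" and zero: "0 \<in> A" "0 \<in> B" and B: "\<And>b. b \<in> B \<Longrightarrow> \<not> P b"
  obtains E where "0 \<in> E" "A = E + {0, g}" "E + B = K"
proof -
  \<comment> \<open>\<open>E\<close> is the part of \<open>A\<close> in \<open>K\<close>, and
    \<open>D\<close> is the part of \<open>A\<close> in the translate of \<open>K\<close>, shifted
    back by \<open>g\<close>.\<close>
  define E D where "E = A \<inter> K" and "D = {k \<in> K. k + g \<in> A}"
  have sub: "A \<subseteq> K + {0, g}" "B \<subseteq> K + {0, g}"
    using zero AB sumset_left_subset[of B A] sumset_right_subset[of A B] by auto
  have BK: "B \<subseteq> K" using sub(2) B P_translate mem_iff by blast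
  have A: "A = E \<union> (\<lambda>k. k + g) ` D"
    using sub(1) mem_iff unfolding E_def D_def by blast
  have inX: "a + b \<in> K + {0, g}" if "a \<in> A" "b \<in> B" for a b
    using that AB by blast
  have EB: "E + B = K"
  proof
    show "E + B \<subseteq> K"
    proof
      fix s assume "s \<in> E + B"
      then obtain e b where eb: "e \<in> A" "e \<in> K" "b \<in> B" "s = e + b"
        unfolding E_def by (auto elim!: set_plus_elim)
      then have s: "s \<in> K + {0, g}" using inX by simp
      then have "\<not> P s" using not_P_add[of e b] eb BK by auto
      then show "s \<in> K" using s P_translate mem_iff by blast
    qed
    show "K \<subseteq> E + B"
    proof
      fix k assume k: "k \<in> K"
      then have kX: "k \<in> K + {0, g}" using mem_iff by blast
      then obtain a b where ab: "a \<in> A" "b \<in> B" "k = a + b" unfolding AB[symmetric] by (auto simp: set_plus_def)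
      have "a \<in> E"
      proof (rule ccontr)
        assume "a \<notin> E"
        then obtain c where "c \<in> D" "a = c + g" using ab(1) unfolding A by blast
        then have "P k" using P_add[of c b] ab BK kX by (auto simp: D_def)
        then show False using not_P k by blast
      qed
      then show "k \<in> E + B" using ab by auto
    qed
  qed
  have DB: "D + B = K"
  proof
    show "D + B \<subseteq> K"
    proof
      fix s assume "s \<in> D + B"
      then obtain e b where eb: "e \<in> D" "b \<in> B" "s = e + b" by (auto simp: set_plus_def)
      then have "(e + g) + b \<in> K + {0, g}" using inX[of "e + g" b] by (auto simp: D_def)
      moreover from this have "P ((e + g) + b)" using P_add[of e b] eb BK by (auto simp: D_def)
      ultimately obtain k where "k \<in> K" "(e + g) + b = k + g" using mem_iff not_P by blast
      then show "s \<in> K" using eb by (simp add: add.assoc add.commute[of g])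
    qed
    show "K \<subseteq> D + B"
    proof
      fix k assume k: "k \<in> K"
      then have kX: "k + g \<in> K + {0, g}" using mem_iff by blast
      then obtain a b where ab: "a \<in> A" "b \<in> B" "k + g = a + b"
        unfolding AB[symmetric] by (auto elim!: set_plus_elim)
      have "a \<notin> K"
      proof
        assume "a \<in> K"
        then have "\<not> P (k + g)" using not_P_add[of a b] ab BK kX by auto
        then show False using P_translate k by blast
      qed
      then have "a \<notin> E" by (simp add: E_def)
      then obtain c where "c \<in> D" "a = c + g" using ab(1) unfolding A by blast
      moreover from this have "k = c + b" using ab(3) by simp
      ultimately show "k \<in> D + B" using ab(2) by blast
    qed
  qed
  have "0 \<in> E" using zero zero_in_K by (simp add: E_def)
  moreover have "0 \<in> D"
  proof -
    obtain e b where "e \<in> D" "b \<in> B" "0 = e + b" using zero_in_K DB by (metis set_plus_elim)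
    then show ?thesis by simp
  qed
  ultimately have "E = D" using cancellable_decompositionsD[OF cancel EB DB] zero by simp
  then show thesis using that[of E] A EB \<open>0 \<in> E\<close> by (simp add: sumset_pair)
qed

lemma g_pos: "g > 0"
  using P_translate[OF zero_in_K] not_P[OF zero_in_K] by (cases g) auto

text \<open>Used to show that in a factorization of \<open>K + {0, g}\<close> some letter has an
  element satisfying \<open>P\<close>: otherwise the whole sum would stay inside
  \<open>K\<close>.\<close>

lemma sum_list_subset:
  assumes "\<forall>A\<in>set w. 0 \<in> A \<and> (\<forall>a\<in>A. \<not> P a)" "sum_list w \<subseteq> K + {0, g}"
  shows "sum_list w \<subseteq> K"
  using assms
proof (induction w)
  case Nil
  then show ?case using zero_in_K by simp
next
  case (Cons A w)
  have zero: "0 \<in> A" "0 \<in> sum_list w"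
    using Cons.prems zero_in_sum_list[of w] by auto
  then have sub: "A \<subseteq> K + {0, g}" "sum_list w \<subseteq> K + {0, g}"
    using Cons.prems(2) sumset_left_subset[of "sum_list w" A] sumset_right_subset[of A "sum_list w"] by auto
  then have IH: "sum_list w \<subseteq> K" using Cons by simp
  have "A \<subseteq> K"
  proof
    fix a assume "a \<in> A"
    then have "\<not> P a" "a \<in> K + {0, g}" using sub(1) Cons.prems(1) by auto
    then show "a \<in> K" using P_translate mem_iff by blast
  qed
  show ?case
  proof
    fix s assume s: "s \<in> sum_list (A # w)"
    then obtain a b where ab: "s = a + b" "a \<in> A" "b \<in> sum_list w"
      by (auto elim: set_plus_elim)
    have sX: "s \<in> K + {0, g}" using s Cons.prems(2) by blast
    have "\<not> P s" using not_P_add[of a b] ab \<open>A \<subseteq> K\<close> IH sX by auto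
    then show "s \<in> K" using sX P_translate mem_iff by blast
  qed
qed

text \<open>Some letter \<open>A\<close> has an element satisfying \<open>P\<close>. If the sum of
  the other letters has none, \<open>decomposition\<close> splits \<open>{0, g}\<close> off from
  \<open>A\<close>, and \<open>A = {0, g}\<close> because \<open>A\<close> is an atom.\<close>

lemma factorization_cases:
  assumes w: "w \<in> factorizations P_fin_0_nat (K + {0, g})"
  obtains
    (split) "{0, g} \<in> set w" "remove1 {0, g} w \<in> factorizations P_fin_0_nat K"
  | (mixed) A a b where "A \<in> set w" "a \<in> A" "P a" "b \<in> sum_list (remove1 A w)" "P b"
proof -
  have at: "set w \<subseteq> atoms P_fin_0_nat" and sum: "sum_list w = K + {0, g}"
    using w by (auto simp: factorizations_P_fin_0_nat_iff)
  have "\<exists>A\<in>set w. \<exists>a\<in>A. P a"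
  proof (rule ccontr)
    assume "\<not> ?thesis"
    moreover have "\<forall>A\<in>set w. 0 \<in> A" using at by (auto simp: atoms_P_fin_0_nat_iff)
    ultimately have "K + {0, g} \<subseteq> K" using sum_list_subset[of w] sum by simp
    moreover have "0 + g \<in> K + {0, g}" using zero_in_K by blast
    ultimately show False using not_P P_translate zero_in_K by blast
  qed
  then obtain A a where A: "A \<in> set w" "a \<in> A" "P a" by blast
  define B where "B = sum_list (remove1 A w)"
  have AB: "A + B = K + {0, g}" using sum_list_remove1[OF A(1)] sum by (simp add: B_def)
  have zero: "0 \<in> A" "0 \<in> B"
    using A(1) at zero_in_sum_list_atoms[of "remove1 A w"] set_remove1_subset[of A w]
    by (auto simp: B_def atoms_P_fin_0_nat_iff)
  show thesis
  proof (cases "\<exists>b\<in>B. P b")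
    case True
    then show thesis using mixed A by (auto simp: B_def)
  next
    case False
    then obtain E where E: "0 \<in> E" "A = E + {0, g}" "E + B = K"
      using decomposition[OF AB zero] by blast
    have "A \<in> atoms P_fin_0_nat" using A at by blast
    then have "E = {0} \<or> {0, g} = {0}"
      unfolding atoms_P_fin_0_nat_iff using E(1,2) by (metis insertI1)
    then have "E = {0}" using g_pos by auto
    then have "A = {0, g}" "B = K" using E by auto
    then show thesis
      using split A at set_remove1_subset[of A w]
      by (auto simp: factorizations_P_fin_0_nat_iff B_def)
  qed
qed

end

section \<open>Cubes\<close>

text \<open>The ratio \<open>4\<close> of consecutive generators keeps even the sum of two elements
  of \<open>cube m\<close> below the next generator \<open>2 * 4 ^ m\<close>.\<close>

primrec cube :: "nat \<Rightarrow> nat set" where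
  "cube 0 = {0}"
| "cube (Suc m) = cube m + {0, 2 * 4 ^ m}"

text \<open>This is \<open>(4 ^ m - 1) / 3\<close>; it will serve as the odd centre \<open>z\<close>
  of \<open>cube m\<close>.\<close>

primrec half_max_cube :: "nat \<Rightarrow> nat" where
  "half_max_cube 0 = 0"
| "half_max_cube (Suc m) = half_max_cube m + 4 ^ m"

lemma finite_cube: "finite (cube m)"
  by (induction m) (auto simp: finite_set_plus)

lemma zero_in_cube: "0 \<in> cube m"
  by (induction m) (auto simp: zero_in_sumset)

lemma even_cube: "k \<in> cube m \<Longrightarrow> even k"
  by (induction m arbitrary: k) (auto simp: sumset_pair)

lemma cube_le: "k \<in> cube m \<Longrightarrow> k \<le> 2 * half_max_cube m"
  by (induction m arbitrary: k) (force simp: sumset_pair)+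

lemma max_in_cube: "2 * half_max_cube m \<in> cube m"
  by (induction m) (auto simp: sumset_pair)

lemma half_max_cube_less: "2 * half_max_cube m < 4 ^ m"
  by (induction m) auto

text \<open>Only the summand \<open>4 ^ 0\<close> is odd.\<close>

lemma odd_half_max_cube: "m \<ge> 1 \<Longrightarrow> odd (half_max_cube m)"
proof (induction m rule: dec_induct)
  case (step n)
  then show ?case by (cases n) auto
qed simp

lemma cube_add_less: "\<lbrakk>a \<in> cube m; b \<in> cube m\<rbrakk> \<Longrightarrow> a + b < 2 * 4 ^ m"
  using cube_le[of a m] cube_le[of b m] half_max_cube_less[of m] by linarith

lemma cube_less: "a \<in> cube m \<Longrightarrow> a < 2 * 4 ^ m"
  using cube_add_less[of a m 0] zero_in_cube[of m] by simp

lemma cube_Suc_less: "a \<in> cube (Suc m) \<Longrightarrow> a < 2 * (2 * 4 ^ m)"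
  using cube_less[of _ m] by (fastforce simp: sumset_pair)

text \<open>Here \<open>P\<close> means large. Cancellation is kept as a premise so that the lemma
  can be applied within the induction that proves cancellation for cubes.\<close>

lemma separated_translate_cube:
  "cancellable_decompositions (cube m) \<Longrightarrow> separated_translate (cube m) (2 * 4 ^ m) ((\<le>) (2 * 4 ^ m))"
  by unfold_locales (use zero_in_cube cube_less cube_add_less in \<open>auto simp: not_le\<close>)

text \<open>If \<open>F\<close> has only small elements, \<open>{0, ?g}\<close> splits off from
  \<open>A\<close> and \<open>B\<close>, and the induction hypothesis compares the remainders. If
  \<open>F\<close> has a large element, \<open>A\<close> and \<open>B\<close> have only small ones,
  so \<open>{0, ?g}\<close> splits off from \<open>F\<close>; the remainder is the small part of
  \<open>F\<close> in both cases, and the induction hypothesis cancels it.\<close>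

lemma cancellable_decompositions_cube: "cancellable_decompositions (cube m)"
proof (induction m)
  case 0
  show ?case using sumset_eq_zero_iff by (auto simp: cancellable_decompositions_def)
next
  case (Suc m)
  let ?g = "2 * 4 ^ m :: nat"
  interpret separated_translate "cube m" ?g "(\<le>) ?g"
    using Suc.IH by (rule separated_translate_cube)
  show ?case
    unfolding cancellable_decompositions_def cube.simps
  proof (intro allI impI)
    fix A B F :: "nat set"
    assume *: "0 \<in> A" "0 \<in> B" "0 \<in> F" "A + F = cube m + {0, ?g}" "B + F = cube m + {0, ?g}"
    show "A = B"
    proof (cases "\<exists>f\<in>F. ?g \<le> f")
      case False
      obtain E where E: "0 \<in> E" "A = E + {0, ?g}" "E + F = cube m"
        using decomposition[OF *(4) *(1,3)] False by blast
      obtain D where D: "0 \<in> D" "B = D + {0, ?g}" "D + F = cube m"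
        using decomposition[OF *(5) *(2,3)] False by blast
      have "E = D" by (rule cancellable_decompositionsD[OF Suc.IH E(3) D(3) E(1) D(1) *(3)])
      then show ?thesis using E D by simp
    next
      case True
      then obtain f where f: "f \<in> F" "?g \<le> f" by blast
      have small: "a < ?g" if "a \<in> C" "C + F = cube m + {0, ?g}" for a C
      proof -
        have "a + f \<in> cube (Suc m)" using that f by auto
        then show ?thesis using cube_Suc_less[of "a + f" m] f by simp
      qed
      have comm: "F + A = cube m + {0, ?g}" "F + B = cube m + {0, ?g}"
        using *(4,5) by (simp_all add: add.commute)
      obtain E where E: "0 \<in> E" "F = E + {0, ?g}" "E + A = cube m"
        using decomposition[OF comm(1) *(3,1)] small[OF _ *(4)] by (metis not_le)
      obtain D where D: "0 \<in> D" "F = D + {0, ?g}" "D + B = cube m"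
        using decomposition[OF comm(2) *(3,2)] small[OF _ *(5)] by (metis not_le)
      have sub: "E \<subseteq> cube m" "D \<subseteq> cube m"
        using E D sumset_left_subset[of A E] sumset_left_subset[of B D] * by auto
      have "E = {e \<in> F. e < ?g}"
        using sub(1) cube_less unfolding E(2) sumset_pair by auto
      moreover have "D = {e \<in> F. e < ?g}"
        using sub(2) cube_less unfolding D(2) sumset_pair by auto
      ultimately have "E = D" by simp
      then show ?thesis
        using cancellable_decompositionsD[OF Suc.IH, of A E B] E D * by (simp add: add.commute)
    qed
  qed
qed

text \<open>Two large elements from different summands would add up to at least
  \<open>2 * ?g\<close>, more than any element of \<open>cube (Suc m)\<close>; so
  \<open>{0, ?g}\<close> is a letter and can be removed.\<close>

lemma length_factorization_cube:
  "w \<in> factorizations P_fin_0_nat (cube m) \<Longrightarrow> length w = m"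
proof (induction m arbitrary: w)
  case 0
  then have "word_prod P_fin_0_nat w \<in> Units P_fin_0_nat" "set w \<subseteq> atoms P_fin_0_nat"
    by (auto simp: Units_P_fin_0_nat factorizations_def)
  then show ?case using nat_sets.word_prod_atoms_Units by simp
next
  case (Suc m)
  let ?g = "2 * 4 ^ m :: nat"
  interpret separated_translate "cube m" ?g "(\<le>) ?g"
    by (rule separated_translate_cube[OF cancellable_decompositions_cube])
  have "w \<in> factorizations P_fin_0_nat (cube m + {0, ?g})" using Suc.prems by simp
  then show ?case
  proof (cases rule: factorization_cases)
    case split
    then have "length (remove1 {0, ?g} w) = m" using Suc.IH by blast
    then show ?thesis using length_remove1_mem[OF split(1)] by simp
  next
    case (mixed A a b)
    then have "a + b \<in> sum_list w" using sum_list_remove1[of A w] by auto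
    then have "a + b \<in> cube (Suc m)" using Suc.prems by (simp add: factorizations_P_fin_0_nat_iff)
    then show ?thesis using cube_Suc_less mixed by fastforce
  qed
qed

lemma factorization_cube_exists: "\<exists>w. w \<in> factorizations P_fin_0_nat (cube m)"
proof (induction m)
  case 0
  then show ?case by (auto simp: factorizations_P_fin_0_nat_iff intro!: exI[of _ "[]"])
next
  case (Suc m)
  then obtain w where "w \<in> factorizations P_fin_0_nat (cube m)" by blast
  then have "{0, 2 * 4 ^ m} # w \<in> factorizations P_fin_0_nat (cube (Suc m))"
    using pair_atom[of "2 * 4 ^ m"] by (auto simp: factorizations_P_fin_0_nat_iff add.commute)
  then show ?case by blast
qed


section \<open>Sumsets with two types of factorizations\<close>

text \<open>Every factorization of \<open>X\<close> contains the atom \<open>a\<close>, and the two types are told apart by the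
  cardinalities of their letters. Cardinalities survive the passage to power monoids of arbitrary
  monoids, where distinct atoms may become associated.\<close>

definition two_types :: "nat \<Rightarrow> nat set \<Rightarrow> nat set \<Rightarrow> nat \<Rightarrow> bool" where
  "two_types m X a q \<longleftrightarrow> finite X \<and> 0 \<in> X \<and> a \<in> atoms P_fin_0_nat \<and>
    (\<forall>w\<in>factorizations P_fin_0_nat X. a \<in> set w \<and>
       (length w = 2 \<and> (\<exists>b\<in>set w. card b = q) \<or> length w = Suc m \<and> (\<forall>b\<in>set w. card b < q))) \<and>
    (\<exists>w\<in>factorizations P_fin_0_nat X. length w = 2 \<and> (\<exists>b\<in>set w. card b = q)) \<and>
    (\<exists>w\<in>factorizations P_fin_0_nat X. length w = Suc m \<and> (\<forall>b\<in>set w. card b < q))"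

text \<open>\<open>K_ne\<close> is what makes \<open>insert z K\<close> an atom: for
  \<open>K = {0, 2 * z}\<close> it would equal \<open>{0, z} + {0, z}\<close>.\<close>

locale even_set_with_odd_centre =
  fixes K :: "nat set" and z m :: nat
  assumes finite_K: "finite K"
    and zero_in_K: "0 \<in> K"
    and even_K: "k \<in> K \<Longrightarrow> even k"
    and K_le: "k \<in> K \<Longrightarrow> k \<le> 2 * z"
    and max_in_K: "2 * z \<in> K"
    and odd_z: "odd z"
    and K_ne: "K \<noteq> {0, 2 * z}"
    and cancel: "cancellable_decompositions K"
    and length_K: "w \<in> factorizations P_fin_0_nat K \<Longrightarrow> length w = m"
    and factorization_K: "\<exists>w. w \<in> factorizations P_fin_0_nat K"
begin

text \<open>Parity separates the even set \<open>K\<close> from its translate by the odd number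
  \<open>z\<close>.\<close>

sublocale separated_translate K z odd
  by unfold_locales (use zero_in_K cancel even_K odd_z in auto)

lemma z_not_in_K: "z \<notin> K"
  using even_K odd_z by blast

lemma insert_z_sum: "insert z K + {0, z} = K + {0, z}"
proof -
  have "z \<in> K + {0, z}" "2 * z \<in> K + {0, z}"
    using zero_in_K max_in_K by (auto simp: mem_iff)
  then show ?thesis by (auto simp: sumset_pair mult_2)
qed

text \<open>Both summands have \<open>z\<close> as their only odd element. Writing
  \<open>k + z\<close> as a sum then shows that each \<open>k \<in> K\<close> lies in
  \<open>A\<close> or \<open>B\<close>, and the summand containing \<open>2 * z\<close> leaves no
  room for nonzero elements of \<open>K\<close> in the other.\<close>

lemma mixed_decomposition:
  assumes AB: "A + B = K + {0, z}" and zero: "0 \<in> A" "0 \<in> B"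
    and odd: "a \<in> A" "odd a" "b \<in> B" "odd b"
  shows "A = {0, z} \<and> B = insert z K \<or> A = insert z K \<and> B = {0, z}"
proof -
  have sub: "A \<subseteq> K + {0, z}" "B \<subseteq> K + {0, z}"
    using zero AB sumset_left_subset[of B A] sumset_right_subset[of A B] by auto
  have inX: "x + y \<in> K + {0, z}" if "x \<in> A" "y \<in> B" for x y
    using that AB by blast
  \<comment> \<open>Odd elements are at least \<open>z\<close>, while their even sum lies in
    \<open>K\<close> and is at most \<open>2 * z\<close>.\<close>
  have oddD: "x = z \<and> y = z" if xy: "x \<in> A" "y \<in> B" "odd x" "odd y" for x y
  proof -
    obtain k l where "k \<in> K" "l \<in> K" "x = k + z" "y = l + z"
      using xy sub even_K mem_iff by blast
    moreover have "x + y \<in> K"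
      using inX[OF xy(1,2)] xy(3,4) P_translate mem_iff by (metis even_add)
    ultimately show ?thesis using K_le[of "x + y"] by auto
  qed
  have zA: "z \<in> A" and zB: "z \<in> B" using oddD odd by blast+
  have A: "A \<subseteq> insert z K"
    using sub(1) oddD[OF _ zB] odd_z mem_iff P_translate by blast
  have B: "B \<subseteq> insert z K"
    using sub(2) oddD[OF zA] odd_z mem_iff P_translate by blast
  have union: "k \<in> A \<or> k \<in> B" if "k \<in> K" for k
  proof -
    have "k + z \<in> A + B" using that by (simp add: AB mem_iff)
    then obtain x y where xy: "k + z = x + y" "x \<in> A" "y \<in> B" by (rule set_plus_elim)
    then have "odd (x + y)" using that P_translate by metis
    then have "x = z \<or> y = z" using xy oddD[OF _ zB] oddD[OF zA] odd_z by auto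
    then show ?thesis using xy by auto
  qed
  have trivial: "y = 0" if "y \<in> K" "2 * z + y \<in> K + {0, z}" for y
  proof -
    have "even (2 * z + y)" using even_K[OF that(1)] by simp
    then have "2 * z + y \<in> K" using that(2) P_translate mem_iff by metis
    then show ?thesis using K_le[of "2 * z + y"] by simp
  qed
  have "2 * z \<in> A \<or> 2 * z \<in> B" using union max_in_K by blast
  then show ?thesis
  proof
    assume "2 * z \<in> A"
    then have "B = {0, z}" using B zero zB inX[of "2 * z"] trivial by blast
    moreover from this have "A = insert z K" using A zA union zero z_not_in_K by blast
    ultimately show ?thesis by simp
  next
    assume "2 * z \<in> B"
    then have "x = 0" if "x \<in> A" "x \<in> K" for x
      using that inX[of x "2 * z"] trivial[of x] by (simp add: add.commute)
    then have "A = {0, z}" using A zero zA by blast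
    moreover from this have "B = insert z K" using B zB union zero z_not_in_K by blast
    ultimately show ?thesis by simp
  qed
qed

text \<open>As \<open>z\<close> is the only odd element, it lies in one summand. Adding it to the
  other leaves \<open>insert z K\<close> except at \<open>0\<close> and \<open>z\<close>; two
  nontrivial summands would thus be inside \<open>{0, z}\<close>, forcing
  \<open>K = {0, 2 * z}\<close>.\<close>

lemma insert_z_atom: "insert z K \<in> atoms P_fin_0_nat"
proof -
  have main: "B = {0}"
    if BC: "insert z K = B + C" and zero: "0 \<in> B" "0 \<in> C" and z: "z \<in> C" for B C
  proof (rule ccontr)
    assume "B \<noteq> {0}"
    then obtain x where x: "x \<in> B" "x \<noteq> 0" using zero by blast
    have sub: "B \<subseteq> insert z K" "C \<subseteq> insert z K"
      using zero BC sumset_left_subset[of C B] sumset_right_subset[of B C] by auto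
    have inX: "x + y \<in> insert z K" if "x \<in> B" "y \<in> C" for x y
      using that BC by blast
    have eq: "y = 0 \<or> y = z" if "y \<in> insert z K" "y + z \<in> insert z K" for y
      using that even_K[of y] even_K[of "y + z"] odd_z by auto
    have "x = z" using eq[of x] inX[of x z] x z sub by auto
    then have "C \<subseteq> {0, z}" using eq inX[of z] x(1) sub by (auto simp: add.commute)
    moreover have "B \<subseteq> {0, z}" using eq inX[of _ z] z sub by blast
    ultimately have "B + C \<subseteq> {0, z} + {0, z}" by (rule set_plus_mono2[rotated])
    also have "\<dots> \<subseteq> {0, z, 2 * z}" by (auto simp: sumset_pair)
    finally have "K \<subseteq> {0, 2 * z}" using BC z_not_in_K by blast
    then show False using K_ne zero_in_K max_in_K by blast
  qed
  have "B = {0} \<or> C = {0}" if BC: "insert z K = B + C" "0 \<in> B" "0 \<in> C" for B C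
  proof -
    obtain b c where bc: "z = b + c" "b \<in> B" "c \<in> C"
      using BC(1) by (metis insertI1 set_plus_elim)
    have "B \<subseteq> insert z K" "C \<subseteq> insert z K"
      using BC sumset_left_subset[of C B] sumset_right_subset[of B C] by auto
    then have "b = z \<or> c = z" using bc even_K odd_z by (metis insertE even_add subsetD)
    then show ?thesis using main[of B C] main[of C B] bc BC by (auto simp: add.commute)
  qed
  moreover have "insert z K \<noteq> {0}" using odd_z by auto
  ultimately show ?thesis using finite_K zero_in_K by (simp add: atoms_P_fin_0_nat_iff)
qed

lemma card_K: "card K \<ge> 2"
proof -
  have "card {0, 2 * z} \<le> card K" using zero_in_K max_in_K finite_K by (intro card_mono) auto
  then show ?thesis using odd_z by (auto simp: card_insert_if split: if_splits)
qed

lemma card_insert_z: "card (insert z K) = Suc (card K)"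
  using finite_K z_not_in_K by simp

lemma card_letter_less:
  assumes "w \<in> factorizations P_fin_0_nat K" "b \<in> set w"
  shows "card b < Suc (card K)"
proof -
  have "\<forall>A\<in>set w. 0 \<in> A" "sum_list w = K"
    using assms(1) by (auto simp: factorizations_P_fin_0_nat_iff atoms_P_fin_0_nat_iff)
  then have "b \<subseteq> K" using subset_sum_list[of w b] assms(2) by blast
  then show ?thesis using finite_K card_mono[of K b] by simp
qed

lemma card_pair_less: "card {0, z} < Suc (card K)"
  using card_K by (simp add: card_insert_if)

text \<open>In the split case all letters other than \<open>{0, z}\<close> are subsets of
  \<open>K\<close>. In the mixed case the remaining letters sum to an atom, so there is only one of
  them.\<close>

lemma factorization_type:
  assumes w: "w \<in> factorizations P_fin_0_nat (K + {0, z})"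
  shows "{0, z} \<in> set w \<and> (length w = 2 \<and> (\<exists>b\<in>set w. card b = Suc (card K)) \<or>
    length w = Suc m \<and> (\<forall>b\<in>set w. card b < Suc (card K)))"
  using w
proof (cases rule: factorization_cases)
  case split
  have "length w = Suc m"
    using length_K[OF split(2)] length_remove1_mem[OF split(1)] by simp
  moreover have "card b < Suc (card K)" if "b \<in> set w" for b
  proof (cases "b = {0, z}")
    case False
    then have "b \<in> set (remove1 {0, z} w)" using that by simp
    then show ?thesis using card_letter_less split(2) by blast
  qed (use card_pair_less in simp)
  ultimately show ?thesis using split(1) by blast
next
  case (mixed A a b)
  let ?u = "remove1 A w"
  have at: "set w \<subseteq> atoms P_fin_0_nat" "set ?u \<subseteq> atoms P_fin_0_nat"
    using w set_remove1_subset[of A w] by (auto simp: factorizations_P_fin_0_nat_iff)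
  have sum: "A + sum_list ?u = K + {0, z}"
    using w sum_list_remove1[OF mixed(1)] by (auto simp: factorizations_P_fin_0_nat_iff)
  have *: "A = {0, z} \<and> sum_list ?u = insert z K \<or> A = insert z K \<and> sum_list ?u = {0, z}"
  proof (rule mixed_decomposition)
    show "0 \<in> A" using mixed(1) at(1) by (auto simp: atoms_P_fin_0_nat_iff)
    show "0 \<in> sum_list ?u" using at(2) by (rule zero_in_sum_list_atoms)
  qed (fact sum mixed)+
  then have "sum_list ?u \<in> atoms P_fin_0_nat"
    using insert_z_atom pair_atom[of z] g_pos by auto
  then have u: "?u = [sum_list ?u]"
    using nat_sets.factorization_of_atom[of ?u] at by (simp add: word_prod_P_fin_0_nat)
  then have "length ?u = 1" by (metis One_nat_def length_Cons list.size(3))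
  then have "length w = 2" using length_remove1_mem[OF mixed(1)] by simp
  moreover have "sum_list ?u \<in> set w"
    using u set_remove1_subset[of A w] by (metis list.set_intros(1) subsetD)
  ultimately show ?thesis using * mixed(1) card_insert_z by metis
qed

lemma two_types: "two_types m (K + {0, z}) {0, z} (Suc (card K))"
proof -
  have "[insert z K, {0, z}] \<in> factorizations P_fin_0_nat (K + {0, z})"
    using insert_z_atom pair_atom[of z] g_pos insert_z_sum
    by (simp add: factorizations_P_fin_0_nat_iff)
  moreover obtain u where u: "u \<in> factorizations P_fin_0_nat K" using factorization_K by blast
  then have "{0, z} # u \<in> factorizations P_fin_0_nat (K + {0, z})"
    using pair_atom[of z] g_pos by (auto simp: factorizations_P_fin_0_nat_iff add.commute)
  moreover have "\<forall>b\<in>set ({0, z} # u). card b < Suc (card K)"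
    using card_letter_less[OF u] card_pair_less by auto
  moreover have "length ({0, z} # u) = Suc m" using length_K[OF u] by simp
  moreover have "\<exists>b\<in>set [insert z K, {0, z}]. card b = Suc (card K)"
    using card_insert_z by simp
  ultimately show ?thesis
    unfolding two_types_def
    using factorization_type finite_K zero_in_K pair_atom[of z] g_pos
    by (intro conjI ballI bexI[of _ "[insert z K, {0, z}]"] bexI[of _ "{0, z} # u"])
      (auto simp: finite_set_plus zero_in_sumset)
qed

end

section \<open>Concrete sets with two types of factorizations\<close>

lemma zero_two_six_atom: "{0, 2, 6} \<in> atoms P_fin_0_nat"
proof -
  have "B = {0} \<or> C = {0}" if *: "0 \<in> B" "0 \<in> C" "{0, 2, 6} = B + C" for B C :: "nat set"
  proof (rule ccontr)
    assume neg: "\<not> ?thesis"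
    have ex: "\<exists>x\<in>A. x = 2 \<or> x = 6" if "A \<noteq> {0}" "A \<subseteq> {0, 2, 6}" "0 \<in> A" for A :: "nat set"
      using that by blast
    have "B \<subseteq> {0, 2, 6}" "C \<subseteq> {0, 2, 6}"
      using sumset_left_subset[OF *(2), of B] sumset_right_subset[OF *(1), of C] unfolding *(3) by blast+
    then obtain b c where "b \<in> B" "b = 2 \<or> b = 6" "c \<in> C" "c = 2 \<or> c = 6"
      using ex[of B] ex[of C] neg *(1,2) by metis
    \<comment> \<open>The possible sums are \<open>4\<close>, \<open>8\<close> and
      \<open>12\<close>.\<close>
    moreover from this have "b + c \<in> {0, 2, 6}" unfolding *(3) by (intro set_plus_intro)
    ultimately show False by auto
  qed
  then show ?thesis by (auto simp: atoms_P_fin_0_nat_iff)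
qed

text \<open>The case \<open>m = 1\<close> needs its own set because \<open>cube 1 = {0, 2}\<close>
  is excluded by \<open>K_ne\<close>.\<close>

lemma two_types_exists:
  assumes "m \<ge> 1" shows "\<exists>X a q. two_types m X a q"
proof (cases "m = 1")
  case True
  have len: "length w = 1" if "w \<in> factorizations P_fin_0_nat {0, 2, 6}" for w
  proof -
    have "w = [{0, 2, 6}]"
      using that nat_sets.factorization_of_atom[of w] zero_two_six_atom
      by (simp add: factorizations_P_fin_0_nat_iff word_prod_P_fin_0_nat)
    then show ?thesis by simp
  qed
  have ex: "\<exists>w. w \<in> factorizations P_fin_0_nat {0, 2, 6}"
    using zero_two_six_atom by (intro exI[of _ "[{0, 2, 6}]"]) (simp add: factorizations_P_fin_0_nat_iff)
  have "even_set_with_odd_centre {0, 2, 6} 3 1"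
  proof unfold_locales
    have "2 \<notin> {0, 2 * 3 :: nat}" by simp
    then show "{0, 2, 6} \<noteq> {0, 2 * 3 :: nat}" by blast
  qed (use len ex atom_cancellable_decompositions[OF zero_two_six_atom] in auto)
  then show ?thesis using even_set_with_odd_centre.two_types True by blast
next
  case False
  then have "m = Suc (m - 1)" "m - 1 = Suc (m - 2)" using assms by auto
  have "even_set_with_odd_centre (cube m) (half_max_cube m) m"
  proof unfold_locales
    \<comment> \<open>The element \<open>2 * 4 ^ (m - 1)\<close> lies strictly between
      \<open>0\<close> and the maximum, since \<open>m - 1 \<ge> 1\<close>.\<close>
    have "2 * 4 ^ (m - 1) \<in> cube m" "2 * half_max_cube (m - 1) \<in> cube m"
      using \<open>m = Suc (m - 1)\<close> zero_in_cube max_in_cube[of "m - 1"]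
      by (metis cube.simps(2) set_plus_intro add_0 insertI1 insertI2 add.right_neutral)+
    moreover have "0 < half_max_cube (m - 1)"
      using \<open>m - 1 = Suc (m - 2)\<close> by (metis half_max_cube.simps(2) add_gr_0 zero_less_numeral zero_less_power)
    moreover have "half_max_cube m = half_max_cube (m - 1) + 4 ^ (m - 1)"
      using \<open>m = Suc (m - 1)\<close> by (metis half_max_cube.simps(2))
    ultimately show "cube m \<noteq> {0, 2 * half_max_cube m}" by auto
  qed (fact finite_cube zero_in_cube even_cube cube_le max_in_cube odd_half_max_cube[OF assms]
      cancellable_decompositions_cube length_factorization_cube factorization_cube_exists)+
  then show ?thesis using even_set_with_odd_centre.two_types by blast
qed

section \<open>Power monoids\<close>

lemma carrier_P_fin_iff: "X \<in> carrier (P_fin H) \<longleftrightarrow> X \<subseteq> carrier H \<and> finite X \<and> X \<noteq> {}"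
  by (simp add: P_fin_def)

lemma mult_P_fin [simp]: "X \<otimes>\<^bsub>P_fin H\<^esub> Y = X <#>\<^bsub>H\<^esub> Y"
  by (simp add: P_fin_def)

lemma one_P_fin [simp]: "\<one>\<^bsub>P_fin H\<^esub> = {\<one>\<^bsub>H\<^esub>}"
  by (simp add: P_fin_def)

lemma carrier_P_fin_units_iff:
  "X \<in> carrier (P_fin_units H) \<longleftrightarrow> X \<in> carrier (P_fin H) \<and> X \<inter> Units H \<noteq> {}"
  by (simp add: P_fin_units_def)

lemma mult_P_fin_units [simp]: "X \<otimes>\<^bsub>P_fin_units H\<^esub> Y = X <#>\<^bsub>H\<^esub> Y"
  by (simp add: P_fin_units_def)

lemma one_P_fin_units [simp]: "\<one>\<^bsub>P_fin_units H\<^esub> = {\<one>\<^bsub>H\<^esub>}"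
  by (simp add: P_fin_units_def)

lemma mem_set_mult_iff: "z \<in> X <#>\<^bsub>H\<^esub> Y \<longleftrightarrow> (\<exists>x\<in>X. \<exists>y\<in>Y. z = x \<otimes>\<^bsub>H\<^esub> y)"
  by (auto simp: set_mult_def)

lemma set_multI: "\<lbrakk>x \<in> X; y \<in> Y\<rbrakk> \<Longrightarrow> x \<otimes>\<^bsub>H\<^esub> y \<in> X <#>\<^bsub>H\<^esub> Y"
  by (auto simp: set_mult_def)

lemma set_mult_nonempty: "\<lbrakk>X \<noteq> {}; Y \<noteq> {}\<rbrakk> \<Longrightarrow> X <#>\<^bsub>H\<^esub> Y \<noteq> {}"
  by (auto simp: set_mult_def)

lemma finite_set_mult: "\<lbrakk>finite X; finite Y\<rbrakk> \<Longrightarrow> finite (X <#>\<^bsub>H\<^esub> Y)"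
  by (auto simp: set_mult_def)

context monoid
begin

lemma monoid_P_fin: "monoid (P_fin G)"
proof (rule monoidI)
  fix X Y assume "X \<in> carrier (P_fin G)" "Y \<in> carrier (P_fin G)"
  then show "X \<otimes>\<^bsub>P_fin G\<^esub> Y \<in> carrier (P_fin G)"
    by (simp add: carrier_P_fin_iff set_mult_closed finite_set_mult set_mult_nonempty)
next
  fix X Y Z assume "X \<in> carrier (P_fin G)" "Y \<in> carrier (P_fin G)" "Z \<in> carrier (P_fin G)"
  then have sub: "X \<subseteq> carrier G" "Y \<subseteq> carrier G" "Z \<subseteq> carrier G" by (auto simp: carrier_P_fin_iff)
  have assoc: "x \<otimes> y \<otimes> z = x \<otimes> (y \<otimes> z)" if "x \<in> X" "y \<in> Y" "z \<in> Z" for x y z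
    using that sub m_assoc by blast
  have "X <#> Y <#> Z = (\<Union>x\<in>X. \<Union>y\<in>Y. \<Union>z\<in>Z. {x \<otimes> y \<otimes> z})"
    by (simp add: set_mult_def)
  also have "\<dots> = (\<Union>x\<in>X. \<Union>y\<in>Y. \<Union>z\<in>Z. {x \<otimes> (y \<otimes> z)})"
    by (intro SUP_cong refl) (simp add: assoc)
  also have "\<dots> = X <#> (Y <#> Z)"
    by (simp add: set_mult_def)
  finally show "X \<otimes>\<^bsub>P_fin G\<^esub> Y \<otimes>\<^bsub>P_fin G\<^esub> Z = X \<otimes>\<^bsub>P_fin G\<^esub> (Y \<otimes>\<^bsub>P_fin G\<^esub> Z)"
    by simp
qed (auto simp: carrier_P_fin_iff set_mult_def subset_iff)

text \<open>All elements of an invertible \<open>X\<close> are inverse to the same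
  \<open>y \<in> Y\<close>, hence equal.\<close>

lemma Units_P_fin: "Units (P_fin G) = (\<lambda>u. {u}) ` Units G"
proof
  show "Units (P_fin G) \<subseteq> (\<lambda>u. {u}) ` Units G"
  proof
    fix X assume "X \<in> Units (P_fin G)"
    then obtain Y where X: "X \<in> carrier (P_fin G)" and Y: "Y \<in> carrier (P_fin G)"
      and XY: "X <#> Y = {\<one>}" "Y <#> X = {\<one>}"
      by (auto simp: Units_def)
    obtain x y where xy: "x \<in> X" "y \<in> Y" using X Y by (auto simp: carrier_P_fin_iff)
    have sub: "X \<subseteq> carrier G" "Y \<subseteq> carrier G" using X Y by (auto simp: carrier_P_fin_iff)
    have 1: "a \<otimes> b = \<one>" "b \<otimes> a = \<one>" if "a \<in> X" "b \<in> Y" for a b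
      using set_multI[OF that, of G] set_multI[OF that(2,1), of G] unfolding XY by simp_all
    have "a = x" if "a \<in> X" for a
      using inv_unique[OF 1(1)[OF that xy(2)] 1(2)[OF xy]] that xy sub by auto
    then have "X = {x}" using xy by blast
    moreover have "x \<in> Units G" using 1[OF xy] xy sub by (auto simp: Units_def)
    ultimately show "X \<in> (\<lambda>u. {u}) ` Units G" by blast
  qed
  show "(\<lambda>u. {u}) ` Units G \<subseteq> Units (P_fin G)"
  proof
    fix X assume "X \<in> (\<lambda>u. {u}) ` Units G"
    then obtain u where u: "u \<in> Units G" "X = {u}" by blast
    then have "{inv u} <#> X = {\<one>}" "X <#> {inv u} = {\<one>}" by (auto simp: set_mult_def)
    then show "X \<in> Units (P_fin G)"
      using u unfolding Units_def[of "P_fin G"]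
      by (auto simp: carrier_P_fin_iff intro!: bexI[of _ "{inv u}"])
  qed
qed

lemma card_translate:
  assumes "u \<in> Units G" "v \<in> Units G" "X \<subseteq> carrier G"
  shows "card ({u} <#> X <#> {v}) = card X"
proof -
  have "{u} <#> X <#> {v} = (\<lambda>t. u \<otimes> t \<otimes> v) ` X" by (auto simp: set_mult_def)
  moreover have "inj_on (\<lambda>t. u \<otimes> t \<otimes> v) X"
  proof (rule inj_onI)
    fix s t assume st: "s \<in> X" "t \<in> X" "u \<otimes> s \<otimes> v = u \<otimes> t \<otimes> v"
    have "inv u \<otimes> (u \<otimes> r \<otimes> v) \<otimes> inv v = r" if "r \<in> X" for r
    proof -
      have "inv u \<otimes> (u \<otimes> r \<otimes> v) \<otimes> inv v = (inv u \<otimes> u) \<otimes> r \<otimes> (v \<otimes> inv v)"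
        using that assms by (simp only: m_assoc Units_closed Units_inv_closed m_closed subsetD)
      then show ?thesis using that assms by auto
    qed
    then show "s = t" using st by metis
  qed
  ultimately show ?thesis by (simp add: card_image)
qed

text \<open>Cardinality is the invariant that tells classes of atoms apart when associations are not
  known explicitly.\<close>

lemma card_atom_class_P_fin:
  assumes "A \<in> atom_class (P_fin G) B" "B \<in> carrier (P_fin G)"
  shows "card A = card B"
  using assms by (auto simp: atom_class_def Units_P_fin card_translate carrier_P_fin_iff)

end

section \<open>Dedekind-finiteness and power monoids\<close>

context df_monoid
begin

lemma df_monoid_P_fin: "df_monoid (P_fin G)"
proof -
  have "Y <#> X = {\<one>}"
    if "X \<in> carrier (P_fin G)" "Y \<in> carrier (P_fin G)" "X <#> Y = {\<one>}" for X Y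
  proof -
    have "y \<otimes> x = \<one>" if "x \<in> X" "y \<in> Y" for x y
      using that one_commute[of x y] set_multI[of x X y Y] \<open>X <#> Y = {\<one>}\<close>
        \<open>X \<in> carrier (P_fin G)\<close> \<open>Y \<in> carrier (P_fin G)\<close>
      by (auto simp: carrier_P_fin_iff subset_iff)
    moreover have "Y <#> X \<noteq> {}" using that by (intro set_mult_nonempty) (auto simp: carrier_P_fin_iff)
    ultimately show ?thesis by (auto simp: set_mult_def)
  qed
  then show ?thesis
    using monoid_P_fin by (auto simp: df_monoid_def df_monoid_axioms_def dedekind_finite_def)
qed

text \<open>In a Dedekind-finite monoid \<open>x \<otimes> y\<close> is a unit exactly if
  \<open>x\<close> and \<open>y\<close> are, so a product of sets meets the units exactly if both
  factors do.\<close>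

lemma divisor_closed_P_fin_units:
  "divisor_closed_submonoid (P_fin G) {X \<in> carrier (P_fin G). X \<inter> Units G \<noteq> {}}"
proof -
  interpret P: df_monoid "P_fin G" by (rule df_monoid_P_fin)
  show ?thesis
  proof unfold_locales
    fix X Y assume XY: "X \<in> carrier (P_fin G)" "Y \<in> carrier (P_fin G)"
    have "X \<otimes>\<^bsub>P_fin G\<^esub> Y \<in> carrier (P_fin G)" using XY by (rule P.m_closed)
    moreover have "(X <#> Y) \<inter> Units G \<noteq> {} \<longleftrightarrow> X \<inter> Units G \<noteq> {} \<and> Y \<inter> Units G \<noteq> {}"
    proof -
      have "x \<otimes> y \<in> Units G \<longleftrightarrow> x \<in> Units G \<and> y \<in> Units G" if "x \<in> X" "y \<in> Y" for x y
        using that XY Units_mult_iff[of x y] by (auto simp: carrier_P_fin_iff)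
      then show ?thesis unfolding set_mult_def by blast
    qed
    ultimately show "X \<otimes>\<^bsub>P_fin G\<^esub> Y \<in> {X \<in> carrier (P_fin G). X \<inter> Units G \<noteq> {}} \<longleftrightarrow>
        X \<in> {X \<in> carrier (P_fin G). X \<inter> Units G \<noteq> {}} \<and> Y \<in> {X \<in> carrier (P_fin G). X \<inter> Units G \<noteq> {}}"
      using XY by simp
  next
    show "\<one>\<^bsub>P_fin G\<^esub> \<in> {X \<in> carrier (P_fin G). X \<inter> Units G \<noteq> {}}"
      using P.one_closed by auto
  qed auto
qed

text \<open>A decomposition \<open>u \<otimes> a \<otimes> v = y \<otimes> z\<close> gives
  \<open>a = (inv u \<otimes> y) \<otimes> (z \<otimes> inv v)\<close>.\<close>

lemma atom_class_atom_aux: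
  assumes "a \<in> atoms G" "b \<in> atom_class G a"
  shows "b \<in> atoms G"
proof -
  obtain u v where uv: "u \<in> Units G" "v \<in> Units G" "b = u \<otimes> a \<otimes> v"
    using assms by (auto simp: atom_class_def)
  have a: "a \<in> carrier G" "a \<notin> Units G" using assms by (auto simp: atoms_def)
  have "b \<notin> Units G" using a uv by (simp add: Units_mult_iff Units_closed)
  moreover have "y \<in> Units G \<or> z \<in> Units G" if yz: "y \<in> carrier G" "z \<in> carrier G" "b = y \<otimes> z" for y z
  proof -
    have "a = inv u \<otimes> b \<otimes> inv v"
    proof -
      have "inv u \<otimes> b \<otimes> inv v = (inv u \<otimes> u) \<otimes> a \<otimes> (v \<otimes> inv v)"
        using a uv by (simp only: m_assoc Units_closed Units_inv_closed m_closed)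
      then show ?thesis using a uv by simp
    qed
    also have "\<dots> = (inv u \<otimes> y) \<otimes> (z \<otimes> inv v)"
      unfolding yz(3) using uv(1,2) yz(1,2) by (simp only: m_assoc Units_closed Units_inv_closed m_closed)
    finally have "inv u \<otimes> y \<in> Units G \<or> z \<otimes> inv v \<in> Units G"
      using atomD[of G "inv u \<otimes> y" "z \<otimes> inv v"] assms(1) uv yz by simp
    then show ?thesis using uv yz by (simp add: Units_mult_iff Units_closed)
  qed
  moreover have "b \<in> carrier G" using a uv by (simp add: Units_closed)
  ultimately show ?thesis by (auto simp: atoms_def)
qed

lemma atom_class_atom_iff:
  assumes "b \<in> atom_class G a" "a \<in> carrier G"
  shows "b \<in> atoms G \<longleftrightarrow> a \<in> atoms G"
  using atom_class_atom_aux assms atom_class_sym by blast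

end

section \<open>Embedding the finite sets of naturals\<close>

locale infinite_order_element = df_monoid +
  fixes x
  assumes x_closed [simp]: "x \<in> carrier G"
    and inj_pow: "inj (\<lambda>n::nat. x [^] n)"
begin

sublocale P: df_monoid "P_fin G"
  by (rule df_monoid_P_fin)

sublocale PU: divisor_closed_submonoid "P_fin G" "{X \<in> carrier (P_fin G). X \<inter> Units G \<noteq> {}}"
  rewrites "P_fin G\<lparr>carrier := {X \<in> carrier (P_fin G). X \<inter> Units G \<noteq> {}}\<rparr> = P_fin_units G"
  by (rule divisor_closed_P_fin_units) (simp add: P_fin_units_def)

sublocale U: df_monoid "P_fin_units G"
  by (rule PU.df_monoid_sub)

definition pow_set :: "nat set \<Rightarrow> 'a set" where
  "pow_set X = (\<lambda>n. x [^] n) ` X"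

lemma pow_set_inject [simp]: "pow_set A = pow_set B \<longleftrightarrow> A = B"
  using inj_pow by (simp add: pow_set_def inj_image_eq_iff)

lemma card_pow_set [simp]: "card (pow_set A) = card A"
  using inj_pow unfolding pow_set_def by (intro card_image) (auto intro: inj_on_subset)

lemma pow_set_zero [simp]: "pow_set {0} = {\<one>}"
  by (simp add: pow_set_def)

lemma pow_set_sumset: "pow_set (A + B) = pow_set A <#> pow_set B"
proof -
  have "pow_set (A + B) = (\<Union>a\<in>A. \<Union>b\<in>B. {x [^] (a + b)})"
    unfolding pow_set_def set_plus_def by blast
  also have "\<dots> = pow_set A <#> pow_set B"
    by (simp add: nat_pow_mult[symmetric] set_mult_def pow_set_def)
  finally show ?thesis .
qed

lemma pow_set_closed:
  assumes "A \<in> carrier P_fin_0_nat" shows "pow_set A \<in> carrier (P_fin_units G)"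
proof -
  have "\<one> \<in> pow_set A"
    using assms unfolding pow_set_def carrier_P_fin_0_nat by (metis (mono_tags) imageI mem_Collect_eq nat_pow_0)
  then show ?thesis
    using assms by (auto simp: carrier_P_fin_units_iff carrier_P_fin_iff carrier_P_fin_0_nat pow_set_def)
qed

lemma Units_P_fin_units: "Units (P_fin_units G) = (\<lambda>u. {u}) ` Units G"
  using PU.Units_sub Units_P_fin by simp

lemma pow_set_Units_iff:
  assumes "0 \<in> A" shows "pow_set A \<in> Units (P_fin_units G) \<longleftrightarrow> A = {0}"
proof
  assume "pow_set A \<in> Units (P_fin_units G)"
  then have "card (pow_set A) = 1" by (auto simp: Units_P_fin_units simp del: card_pow_set)
  then have "card A = 1" by simp
  then show "A = {0}" using assms by (auto simp: card_1_singleton_iff)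
qed (use Units_P_fin_units in auto)

text \<open>Some \<open>y \<in> Y\<close> and \<open>z \<in> Z\<close> satisfy \<open>y \<otimes> z = \<one>\<close>, hence are units by Dedekind-finiteness;
  moving \<open>y\<close> from the left to the right factor makes both factors contain \<open>\<one>\<close>, hence lie inside
  the set of powers.\<close>

lemma pow_set_factors:
  assumes YZ: "Y \<in> carrier (P_fin_units G)" "Z \<in> carrier (P_fin_units G)" "Y <#> Z = pow_set X"
    and X: "X \<in> carrier P_fin_0_nat"
  obtains u B C where "u \<in> Units G" "B \<in> carrier P_fin_0_nat" "C \<in> carrier P_fin_0_nat"
    "B + C = X" "Y = pow_set B <#> {u}" "Z = {inv u} <#> pow_set C"
proof -
  have sub: "Y \<subseteq> carrier G" "Z \<subseteq> carrier G"
    using YZ by (auto simp: carrier_P_fin_units_iff carrier_P_fin_iff)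
  have "\<one> \<in> Y <#> Z"
    using X unfolding YZ(3) pow_set_def carrier_P_fin_0_nat by (metis (mono_tags) imageI mem_Collect_eq nat_pow_0)
  then obtain y z where yz: "y \<in> Y" "z \<in> Z" "\<one> = y \<otimes> z" by (auto simp: mem_set_mult_iff)
  then have yU: "y \<in> Units G" using mult_one_Units(1)[of y z] sub by auto
  define Y' Z' where "Y' = Y <#> {inv y}" and "Z' = {y} <#> Z"
  have U: "{y} \<in> Units (P_fin_units G)" "{inv y} \<in> Units (P_fin_units G)"
    using yU by (auto simp: Units_P_fin_units)
  then have car: "{y} \<in> carrier (P_fin_units G)" "{inv y} \<in> carrier (P_fin_units G)"
    by (auto simp: Units_def)
  have inv: "{inv y} <#> {y} = {\<one>}" using yU by (auto simp: set_mult_def)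
  have assoc: "A <#> B <#> C = A <#> (B <#> C)"
    if "A \<in> carrier (P_fin_units G)" "B \<in> carrier (P_fin_units G)" "C \<in> carrier (P_fin_units G)" for A B C
    using U.m_assoc[of A B C] that by simp
  have one: "A <#> {\<one>} = A" "{\<one>} <#> A = A" if "A \<in> carrier (P_fin_units G)" for A
    using that U.r_one[of A] U.l_one[of A] by simp_all
  have closed: "A <#> B \<in> carrier (P_fin_units G)"
    if "A \<in> carrier (P_fin_units G)" "B \<in> carrier (P_fin_units G)" for A B
    using that U.m_closed[of A B] by simp
  have Y: "Y = Y' <#> {y}"
    using assoc[OF YZ(1) car(2,1)] by (simp add: Y'_def inv one YZ)
  have Z: "Z = {inv y} <#> Z'"
    using assoc[OF car(2,1) YZ(2)] by (simp add: Z'_def inv one YZ)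
  have "Y' <#> Z' = Y' <#> {y} <#> Z"
    unfolding Z'_def using assoc[of Y' "{y}" Z] closed car YZ by (simp add: Y'_def)
  then have prod: "Y' <#> Z' = pow_set X" using Y YZ(3) by simp
  have "\<one> \<in> Y'" unfolding Y'_def using set_multI[OF yz(1), of "inv y" "{inv y}" G] yU by simp
  have "\<one> \<in> Z'" unfolding Z'_def yz(3) using yz(2) by (intro set_multI) simp_all
  have sub': "Y' \<subseteq> carrier G" "Z' \<subseteq> carrier G"
    using sub yU by (auto simp: Y'_def Z'_def mem_set_mult_iff subset_iff)
  have "Y' \<subseteq> pow_set X"
  proof
    fix t assume "t \<in> Y'"
    then have "t \<otimes> \<one> \<in> pow_set X" using set_multI[of t Y' \<one> Z' G] \<open>\<one> \<in> Z'\<close> prod by simp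
    then show "t \<in> pow_set X" using sub' \<open>t \<in> Y'\<close> by auto
  qed
  then obtain B where B: "Y' = pow_set B" "B \<subseteq> X" by (auto simp: pow_set_def subset_image_iff)
  have "Z' \<subseteq> pow_set X"
  proof
    fix t assume "t \<in> Z'"
    then have "\<one> \<otimes> t \<in> pow_set X" using set_multI[of \<one> Y' t Z' G] \<open>\<one> \<in> Y'\<close> prod by simp
    then show "t \<in> pow_set X" using sub' \<open>t \<in> Z'\<close> by auto
  qed
  then obtain C where C: "Z' = pow_set C" "C \<subseteq> X" by (auto simp: pow_set_def subset_image_iff)
  have zero: "0 \<in> A" if one: "\<one> \<in> pow_set A" for A
  proof -
    obtain n where "n \<in> A" "\<one> = x [^] n" using one unfolding pow_set_def by auto
    moreover from this have "x [^] (0::nat) = x [^] n" by simp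
    ultimately show ?thesis using injD[OF inj_pow] by blast
  qed
  have "B + C = X" using prod B C pow_set_sumset pow_set_inject by metis
  moreover have "B \<in> carrier P_fin_0_nat" "C \<in> carrier P_fin_0_nat"
    using zero B C X \<open>\<one> \<in> Y'\<close> \<open>\<one> \<in> Z'\<close> finite_subset by (auto simp: carrier_P_fin_0_nat)
  ultimately show thesis using that yU B C Y Z by simp
qed

text \<open>Decompositions of \<open>A\<close> are mapped to decompositions of
  \<open>pow_set A\<close>; conversely \<open>pow_set_factors\<close> returns every decomposition of
  \<open>pow_set A\<close> to one of \<open>A\<close>, up to a unit between the factors.\<close>

lemma pow_set_atom_iff:
  assumes "A \<in> carrier P_fin_0_nat"
  shows "pow_set A \<in> atoms (P_fin_units G) \<longleftrightarrow> A \<in> atoms P_fin_0_nat"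
proof
  assume at: "pow_set A \<in> atoms (P_fin_units G)"
  have fin: "finite A" "0 \<in> A" using assms by (auto simp: carrier_P_fin_0_nat)
  have "B = {0} \<or> C = {0}" if "0 \<in> B" "0 \<in> C" "A = B + C" for B C
  proof -
    have "B \<subseteq> A" "C \<subseteq> A"
      using that sumset_left_subset[of C B] sumset_right_subset[of B C] by auto
    then have "B \<in> carrier P_fin_0_nat" "C \<in> carrier P_fin_0_nat"
      using fin that finite_subset by (auto simp: carrier_P_fin_0_nat)
    then have "pow_set B \<in> Units (P_fin_units G) \<or> pow_set C \<in> Units (P_fin_units G)"
      using atomD[of "P_fin_units G" "pow_set B" "pow_set C"] at that pow_set_closed
      by (simp add: pow_set_sumset)
    then show ?thesis using that pow_set_Units_iff by blast
  qed
  moreover have "A \<noteq> {0}" using at pow_set_Units_iff[of A] fin by (auto simp: atoms_def)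
  ultimately show "A \<in> atoms P_fin_0_nat" using fin by (auto simp: atoms_P_fin_0_nat_iff)
next
  assume at: "A \<in> atoms P_fin_0_nat"
  have "Y \<in> Units (P_fin_units G) \<or> Z \<in> Units (P_fin_units G)"
    if YZ: "Y \<in> carrier (P_fin_units G)" "Z \<in> carrier (P_fin_units G)" "pow_set A = Y <#> Z" for Y Z
  proof -
    obtain u B C where u: "u \<in> Units G" and BC: "B \<in> carrier P_fin_0_nat" "C \<in> carrier P_fin_0_nat"
      "B + C = A" and Y: "Y = pow_set B <#> {u}" and Z: "Z = {inv u} <#> pow_set C"
      using pow_set_factors[OF YZ(1,2) YZ(3)[symmetric] assms] .
    have "B = {0} \<or> C = {0}" using at BC by (auto simp: atoms_P_fin_0_nat_iff carrier_P_fin_0_nat)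
    then have "Y = {u} \<or> Z = {inv u}" using Y Z u by (auto simp: set_mult_def)
    then show ?thesis using u by (auto simp: Units_P_fin_units)
  qed
  moreover have "pow_set A \<notin> Units (P_fin_units G)"
    using at pow_set_Units_iff by (auto simp: atoms_P_fin_0_nat_iff)
  ultimately show "pow_set A \<in> atoms (P_fin_units G)"
    using pow_set_closed[OF assms] by (auto simp: atoms_def)
qed

text \<open>The unit \<open>u\<close> on the left makes the induction work: splitting off the first
  letter leaves a unit in front of the remaining product.\<close>

lemma word_pull_back:
  assumes "set W \<subseteq> carrier (P_fin_units G)" "word_prod (P_fin_units G) W = {u} <#> pow_set X"
    "u \<in> Units G" "X \<in> carrier P_fin_0_nat"
  shows "\<exists>w. set w \<subseteq> carrier P_fin_0_nat \<and> sum_list w = X \<and>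
    list_all2 (\<lambda>A B. A \<in> atom_class (P_fin_units G) (pow_set B)) W w"
  using assms
proof (induction W arbitrary: u X)
  case Nil
  \<comment> \<open>For the empty word the product is a singleton, and comparing cardinalities gives
    \<open>X = {0}\<close>.\<close>
  then have "card ({u} <#> pow_set X <#> {\<one>}) = card X"
    using card_translate[of u \<one> "pow_set X"] pow_set_closed[of X]
    by (auto simp: carrier_P_fin_units_iff carrier_P_fin_iff)
  moreover have "{u} <#> pow_set X <#> {\<one>} = {\<one>}"
    unfolding Nil.prems(2)[symmetric] by (simp add: set_mult_def)
  ultimately have "card X = 1" by simp
  then have "X = {0}" using Nil by (auto simp: card_1_singleton_iff carrier_P_fin_0_nat)
  then show ?case by simp
next
  case (Cons A W)
  let ?M = "P_fin_units G"
  define P where "P = word_prod ?M W"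
  have A: "A \<in> carrier ?M" and P: "P \<in> carrier ?M"
    using Cons.prems U.word_prod_closed[of W] by (auto simp: P_def)
  have uU: "{u} \<in> Units ?M" "{inv u} \<in> Units ?M" using Cons.prems by (auto simp: Units_P_fin_units)
  then have uc: "{u} \<in> carrier ?M" "{inv u} \<in> carrier ?M" by (auto simp: Units_def)
  have inv: "{inv u} <#> {u} = {\<one>}" "{u} <#> {inv u} = {\<one>}"
    using Cons.prems by (auto simp: set_mult_def)
  have Xc: "pow_set X \<in> carrier ?M" using Cons.prems pow_set_closed by blast
  have "{inv u} <#> A <#> P = {inv u} <#> (A <#> P)"
    using U.m_assoc[OF uc(2) A P] by simp
  also have "\<dots> = {inv u} <#> {u} <#> pow_set X"
    using Cons.prems(2) U.m_assoc[OF uc(2,1) Xc] by (simp add: P_def)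
  also have "\<dots> = pow_set X" using U.l_one[OF Xc] inv by simp
  finally have prod: "{inv u} <#> A <#> P = pow_set X" .
  have "{inv u} <#> A \<in> carrier ?M" using U.m_closed[OF uc(2) A] by simp
  then obtain v B C where v: "v \<in> Units G" and BC: "B \<in> carrier P_fin_0_nat" "C \<in> carrier P_fin_0_nat"
    "B + C = X" and AB: "{inv u} <#> A = pow_set B <#> {v}" and PC: "P = {inv v} <#> pow_set C"
    using pow_set_factors[OF _ P prod Cons.prems(4)] by metis
  have "set W \<subseteq> carrier ?M" using Cons.prems by auto
  then obtain w where w: "set w \<subseteq> carrier P_fin_0_nat" "sum_list w = C"
    "list_all2 (\<lambda>A B. A \<in> atom_class ?M (pow_set B)) W w"
    using Cons.IH[of "inv v" C] PC v BC by (auto simp: P_def)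
  have "A = {u} <#> {inv u} <#> A" using U.l_one[OF A] inv by simp
  also have "\<dots> = {u} <#> (pow_set B <#> {v})"
    using U.m_assoc[OF uc A] AB by simp
  also have "\<dots> = {u} <#> pow_set B <#> {v}"
    using U.m_assoc[OF uc(1) pow_set_closed[OF BC(1)], of "{v}"] v
    by (simp add: carrier_P_fin_units_iff carrier_P_fin_iff Units_closed)
  finally have "A \<in> atom_class ?M (pow_set B)"
    using v Cons.prems(3) by (auto simp: atom_class_def Units_P_fin_units)
  then show ?case using w BC by (intro exI[of _ "B # w"]) simp
qed

text \<open>Being an atom is invariant under association and reflected by \<open>pow_set\<close>, so
  the letters pulled back are atoms.\<close>

lemma factorization_pull_back:
  assumes "W \<in> factorizations (P_fin_units G) (pow_set X)" "X \<in> carrier P_fin_0_nat"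
  obtains w where "w \<in> factorizations P_fin_0_nat X"
    "list_all2 (\<lambda>A B. A \<in> atom_class (P_fin_units G) (pow_set B)) W w"
proof -
  let ?M = "P_fin_units G"
  have at: "set W \<subseteq> atoms ?M" and prod: "word_prod ?M W = pow_set X"
    using assms by (auto simp: factorizations_def)
  have "{\<one>} <#> pow_set X = pow_set X" using U.l_one[OF pow_set_closed[OF assms(2)]] by simp
  then obtain w where w: "set w \<subseteq> carrier P_fin_0_nat" "sum_list w = X"
    "list_all2 (\<lambda>A B. A \<in> atom_class ?M (pow_set B)) W w"
    using word_pull_back[of W \<one> X] at prod assms(2) atoms_subset_carrier[of ?M] by force
  have "set w \<subseteq> atoms P_fin_0_nat"
  proof
    fix B assume B: "B \<in> set w"
    then obtain A where A: "A \<in> set W" "A \<in> atom_class ?M (pow_set B)"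
      using w(3) by (metis in_set_conv_nth list_all2_conv_all_nth)
    have "pow_set B \<in> atoms ?M"
      using A at U.atom_class_atom_iff[OF A(2)] pow_set_closed[of B] B w by blast
    then show "B \<in> atoms P_fin_0_nat" using pow_set_atom_iff B w by blast
  qed
  then show thesis using that w by (simp add: factorizations_P_fin_0_nat_iff)
qed

lemma factorization_push_forward:
  assumes "w \<in> factorizations P_fin_0_nat X"
  shows "map pow_set w \<in> factorizations (P_fin_units G) (pow_set X)"
proof -
  have "word_prod (P_fin_units G) (map pow_set w) = pow_set (sum_list w)"
    by (induction w) (simp_all add: pow_set_sumset)
  moreover have "set (map pow_set w) \<subseteq> atoms (P_fin_units G)"
    using assms pow_set_atom_iff[OF atoms_closed] by (auto simp: factorizations_P_fin_0_nat_iff)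
  ultimately show ?thesis using assms by (auto simp: factorizations_def factorizations_P_fin_0_nat_iff word_prod_P_fin_0_nat)
qed

lemma length_set_pow_set:
  assumes "X \<in> carrier P_fin_0_nat"
  shows "length_set (P_fin_units G) (pow_set X) = length_set P_fin_0_nat X"
proof -
  have "(\<exists>w\<in>factorizations (P_fin_units G) (pow_set X). length w = k) \<longleftrightarrow>
      (\<exists>w\<in>factorizations P_fin_0_nat X. length w = k)" for k
  proof
    assume "\<exists>w\<in>factorizations (P_fin_units G) (pow_set X). length w = k"
    then obtain W where W: "W \<in> factorizations (P_fin_units G) (pow_set X)" "length W = k" by blast
    then show "\<exists>w\<in>factorizations P_fin_0_nat X. length w = k"
      using factorization_pull_back[OF W(1) assms] list_all2_lengthD by metis
  next
    assume "\<exists>w\<in>factorizations P_fin_0_nat X. length w = k"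
    then show "\<exists>w\<in>factorizations (P_fin_units G) (pow_set X). length w = k"
      using factorization_push_forward length_map by metis
  qed
  moreover have "pow_set X = {\<one>} \<longleftrightarrow> X = {0}" using pow_set_inject[of X "{0}"] by simp
  ultimately show ?thesis by (simp add: length_set_def one_P_fin_0_nat)
qed

section \<open>Comparison of lengths and catenary degrees\<close>

lemma system_of_lengths_P_fin_0_nat_subset:
  "system_of_lengths P_fin_0_nat \<subseteq> system_of_lengths (P_fin_units G)"
  using length_set_pow_set[symmetric] pow_set_closed unfolding system_of_lengths_def by blast

lemma system_of_lengths_P_fin_units_subset:
  "system_of_lengths (P_fin_units G) \<subseteq> system_of_lengths (P_fin G)"
  by (rule PU.system_of_lengths_sub)

lemma catenary_set_P_fin_units_subset: "catenary_set (P_fin_units G) \<subseteq> catenary_set (P_fin G)"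
  by (rule PU.catenary_set_sub)

lemma card_atom_class_P_fin_units:
  assumes "A \<in> atom_class (P_fin_units G) B" "B \<in> carrier (P_fin_units G)"
  shows "card A = card B"
  using assms card_atom_class_P_fin PU.atom_class_sub by (simp add: carrier_P_fin_units_iff)

lemma two_types_pow_set:
  assumes t: "two_types m X a q" and W: "W \<in> factorizations (P_fin_units G) (pow_set X)"
  shows "\<exists>b\<in>set W. b \<in> atom_class (P_fin_units G) (pow_set a)"
    and "length W = 2 \<and> (\<exists>b\<in>set W. card b = q) \<or> length W = Suc m \<and> (\<forall>b\<in>set W. card b < q)"
proof -
  have "X \<in> carrier P_fin_0_nat" using t by (simp add: two_types_def carrier_P_fin_0_nat)
  then obtain w where w: "w \<in> factorizations P_fin_0_nat X"
    and rel: "list_all2 (\<lambda>A B. A \<in> atom_class (P_fin_units G) (pow_set B)) W w"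
    using factorization_pull_back[OF W] by blast
  have a: "a \<in> set w"
    and type: "length w = 2 \<and> (\<exists>b\<in>set w. card b = q) \<or> length w = Suc m \<and> (\<forall>b\<in>set w. card b < q)"
    using t w by (auto simp: two_types_def)
  have car: "pow_set B \<in> carrier (P_fin_units G)" if "B \<in> set w" for B
    using that w pow_set_closed[OF atoms_closed] by (auto simp: factorizations_P_fin_0_nat_iff)
  show "\<exists>b\<in>set W. b \<in> atom_class (P_fin_units G) (pow_set a)"
    using a rel by (metis in_set_conv_nth list_all2_conv_all_nth)
  have "length W = length w" using rel by (rule list_all2_lengthD)
  moreover have card: "card (W ! i) = card (w ! i)" if "i < length w" for i
  proof -
    have "W ! i \<in> atom_class (P_fin_units G) (pow_set (w ! i))"
      using rel that calculation by (simp add: list_all2_conv_all_nth)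
    then show ?thesis using card_atom_class_P_fin_units car[of "w ! i"] that by simp
  qed
  ultimately have "map card W = map card w" by (intro nth_equalityI) auto
  then have "card ` set W = card ` set w" by (metis list.set_map)
  then have "q \<in> card ` set W \<longleftrightarrow> q \<in> card ` set w" "card ` set W \<subseteq> {..<q} \<longleftrightarrow> card ` set w \<subseteq> {..<q}"
    by simp_all
  then have "(\<exists>b\<in>set W. card b = q) \<longleftrightarrow> (\<exists>b\<in>set w. card b = q)"
    "(\<forall>b\<in>set W. card b < q) \<longleftrightarrow> (\<forall>b\<in>set w. card b < q)"
    by (simp_all add: image_iff image_subset_iff eq_commute)
  then show "length W = 2 \<and> (\<exists>b\<in>set W. card b = q) \<or> length W = Suc m \<and> (\<forall>b\<in>set W. card b < q)"
    using type \<open>length W = length w\<close> by simp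
qed

text \<open>Upper bound: lengths are at most \<open>m + 1\<close> and the class of
  \<open>pow_set a\<close> is always shared. Lower bound: the letter of cardinality \<open>q\<close>
  in the word of length \<open>2\<close> is in no class of the longer word, so at most one letter is
  matched.\<close>

lemma catenary_degree_pow_set:
  assumes t: "two_types m X a q" and m: "m \<ge> 1"
  shows "catenary_degree (P_fin_units G) (pow_set X) = enat m"
proof (rule antisym)
  let ?M = "P_fin_units G"
  have a: "pow_set a \<in> atoms ?M"
    using t pow_set_atom_iff[OF atoms_closed] by (simp add: two_types_def)
  note types = two_types_pow_set[OF t]
  show "catenary_degree ?M (pow_set X) \<le> enat m"
  proof (rule catenary_degree_le)
    fix W W' assume W: "W \<in> factorizations ?M (pow_set X)" "W' \<in> factorizations ?M (pow_set X)"
    obtain b b' where "b \<in> set W" "b \<in> atom_class ?M (pow_set a)"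
      "b' \<in> set W'" "b' \<in> atom_class ?M (pow_set a)"
      using types(1) W by meson
    then have "word_meet ?M W W' \<le> real (max (length W) (length W')) - 1"
      using U.word_meet_le_common_letter[OF a] by blast
    moreover have "max (length W) (length W') \<le> Suc m"
      using types(2)[OF W(1)] types(2)[OF W(2)] m by auto
    ultimately show "word_meet ?M W W' \<le> real m" by linarith
  qed
  let ?P = "\<lambda>W. length W = 2 \<and> (\<exists>b\<in>set W. card b = q)"
  obtain w w' where w: "w \<in> factorizations P_fin_0_nat X" "length w = 2" "\<exists>b\<in>set w. card b = q"
    and w': "w' \<in> factorizations P_fin_0_nat X" "\<forall>b\<in>set w'. card b < q"
    using t by (auto simp: two_types_def)
  show "enat m \<le> catenary_degree ?M (pow_set X)"
  proof (rule catenary_degree_ge[where P = ?P])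
    fix V V' assume V: "V \<in> factorizations ?M (pow_set X)" "V' \<in> factorizations ?M (pow_set X)"
      "?P V" "\<not> ?P V'"
    have V': "length V' = Suc m" "\<forall>b\<in>set V'. card b < q" using types(2)[OF V(2)] V(4) by auto
    obtain b where b: "b \<in> set V" "card b = q" using V(3) by blast
    have "b \<notin> A" if A: "A \<in> common_classes ?M V V'" for A
    proof
      assume "b \<in> A"
      obtain b' where b': "b' \<in> set V'" "b' \<in> A" "A \<in> atom_classes ?M"
        using A unfolding common_classes_eq by blast
      have "b \<in> atom_class ?M b'" using U.atom_classes_member b' \<open>b \<in> A\<close> by blast
      moreover have "b' \<in> carrier ?M"
        using b'(1) V(2) atoms_closed[of b' ?M] by (auto simp: factorizations_def)
      ultimately have "card b = card b'" by (rule card_atom_class_P_fin_units)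
      then show False using V'(2) b'(1) b(2) by auto
    qed
    then have "word_meet ?M V V' \<ge> real (max (length V) (length V')) - real (length V - 1)"
      using U.word_meet_ge_isolated_letter b(1) by blast
    \<comment> \<open>The bound reads \<open>(m + 1) - (2 - 1)\<close>.\<close>
    then show "real m \<le> word_meet ?M V V'" using V(3) V'(1) m by simp
  next
    show "map pow_set w \<in> factorizations ?M (pow_set X)" "map pow_set w' \<in> factorizations ?M (pow_set X)"
      using w w' factorization_push_forward by blast+
    show "?P (map pow_set w)" "\<not> ?P (map pow_set w')"
      using w w' by auto
  qed
qed

lemma catenary_set_P_fin_units_superset: "enat ` {1..} \<subseteq> catenary_set (P_fin_units G)"
proof
  fix e assume "e \<in> enat ` {1..}"
  then obtain m where m: "e = enat m" "m \<ge> 1" by auto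
  obtain X a q where t: "two_types m X a q" using two_types_exists[OF m(2)] by blast
  then have "pow_set X \<in> carrier (P_fin_units G)"
    by (intro pow_set_closed) (simp add: two_types_def carrier_P_fin_0_nat)
  then show "e \<in> catenary_set (P_fin_units G)"
    using catenary_degree_pow_set[OF t m(2)] m by (force simp: catenary_set_def zero_enat_def)
qed

end

section \<open>Elements of infinite order\<close>

text \<open>If \<open>x\<close> had equal powers with exponents \<open>i < j\<close>, every power
  could be reduced to an exponent below \<open>j\<close>, leaving finitely many.\<close>

lemma infinite_order_element_exists:
  assumes "monoid H" "dedekind_finite H" "non_torsion H"
  shows "\<exists>x. infinite_order_element H x"
proof -
  interpret df_monoid H
    using assms by (simp add: df_monoid_def df_monoid_axioms_def)
  obtain x where x: "x \<in> carrier H" "infinite {x [^]\<^bsub>H\<^esub> n | n::nat. n \<ge> 1}"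
    using assms(3) by (auto simp: non_torsion_def)
  have "x [^]\<^bsub>H\<^esub> i \<noteq> x [^]\<^bsub>H\<^esub> j" if ij: "i < j" for i j :: nat
  proof
    assume eq: "x [^]\<^bsub>H\<^esub> i = x [^]\<^bsub>H\<^esub> j"
    have "x [^]\<^bsub>H\<^esub> n \<in> (\<lambda>k. x [^]\<^bsub>H\<^esub> k) ` {..<j}" for n :: nat
    proof (induction n rule: less_induct)
      case (less n)
      show ?case
      proof (cases "n < j")
        case False
        then have "x [^]\<^bsub>H\<^esub> n = x [^]\<^bsub>H\<^esub> j \<otimes>\<^bsub>H\<^esub> x [^]\<^bsub>H\<^esub> (n - j)"
          using x by (simp add: nat_pow_mult)
        also have "\<dots> = x [^]\<^bsub>H\<^esub> (i + (n - j))"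
          using x eq[symmetric] by (simp add: nat_pow_mult)
        finally show ?thesis using less.IH[of "i + (n - j)"] ij False by simp
      qed auto
    qed
    then have "{x [^]\<^bsub>H\<^esub> n | n::nat. n \<ge> 1} \<subseteq> (\<lambda>k. x [^]\<^bsub>H\<^esub> k) ` {..<j}" by blast
    then show False using x(2) finite_subset by blast
  qed
  then have "inj (\<lambda>n::nat. x [^]\<^bsub>H\<^esub> n)"
    by (intro linorder_injI) auto
  then show ?thesis
    using x(1) by (intro exI[of _ x] infinite_order_element.intro infinite_order_element_axioms.intro)
      unfold_locales
qed

lemma infinite_order_element_nat: "infinite_order_element nat_add_monoid 1"
proof -
  have "monoid nat_add_monoid"
    by (rule monoidI) (auto simp: nat_add_monoid_def)
  moreover have "dedekind_finite nat_add_monoid"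
    by (simp add: dedekind_finite_def nat_add_monoid_def)
  moreover have "1 [^]\<^bsub>nat_add_monoid\<^esub> n = n" for n :: nat
    by (induction n) (simp_all add: nat_add_monoid_def)
  ultimately show ?thesis
    by (simp add: infinite_order_element_def infinite_order_element_axioms_def df_monoid_def
        df_monoid_axioms_def inj_def) (simp add: nat_add_monoid_def)
qed

text \<open>Through this identification, results on \<open>P_fin_units\<close> specialize to
  \<open>P_fin_0_nat\<close>, with \<open>1\<close> as the element of infinite order.\<close>

lemma P_fin_units_nat: "P_fin_units nat_add_monoid = P_fin_0_nat"
proof -
  have "Units nat_add_monoid = {0}" by (auto simp: Units_def nat_add_monoid_def)
  then show ?thesis by (auto simp: P_fin_units_def P_fin_one_def nat_add_monoid_def)
qed

section \<open>The restricted power monoid of the naturals\<close>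

text \<open>Each letter has a positive element; their sum is at least the number of letters.\<close>

lemma length_le_member_of_sum_list:
  "set w \<subseteq> atoms P_fin_0_nat \<Longrightarrow> \<exists>s\<in>sum_list w. length w \<le> s"
proof (induction w)
  case (Cons A w)
  then obtain s where s: "s \<in> sum_list w" "length w \<le> s" by auto
  have "0 \<in> A" "A \<noteq> {0}" using Cons.prems by (auto simp: atoms_P_fin_0_nat_iff)
  then obtain a where "a \<in> A" "a \<noteq> 0" by blast
  then have "a + s \<in> sum_list (A # w)" "length (A # w) \<le> a + s" using s by auto
  then show ?case by blast
qed simp

lemma catenary_set_P_fin_0_nat: "catenary_set P_fin_0_nat = enat ` {1..}"
proof
  show "catenary_set P_fin_0_nat \<subseteq> enat ` {1..}"
  proof (rule catenary_set_subset_of_bounded_lengths)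
    fix X assume "X \<in> carrier P_fin_0_nat"
    then have "finite X" by (simp add: carrier_P_fin_0_nat)
    have "length w \<le> Max X" if w: "w \<in> factorizations P_fin_0_nat X" for w
    proof -
      obtain s where "s \<in> X" "length w \<le> s"
        using w length_le_member_of_sum_list[of w] by (auto simp: factorizations_P_fin_0_nat_iff)
      then show ?thesis using Max_ge[OF \<open>finite X\<close>] le_trans by blast
    qed
    then show "\<exists>b. \<forall>w\<in>factorizations P_fin_0_nat X. length w \<le> b" by blast
  qed
  show "enat ` {1..} \<subseteq> catenary_set P_fin_0_nat"
    using infinite_order_element.catenary_set_P_fin_units_superset[OF infinite_order_element_nat]
    by (simp add: P_fin_units_nat)
qed

section \<open>Realizing lengths in \<open>P_fin_0_nat\<close>\<close>

lemma length_in_length_set: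
  assumes "w \<in> factorizations P_fin_0_nat X" "w \<noteq> []"
  shows "length w \<in> length_set P_fin_0_nat X"
proof -
  have "X \<noteq> {0}"
    using assms nat_sets.word_prod_atoms_Units[of w]
    by (auto simp: factorizations_P_fin_0_nat_iff word_prod_P_fin_0_nat Units_P_fin_0_nat)
  then show ?thesis using assms by (auto simp: length_set_def one_P_fin_0_nat Suc_le_eq)
qed

lemma length_set_two_types:
  assumes t: "two_types m X a q"
  shows "length_set P_fin_0_nat X = {2, Suc m}"
proof -
  obtain w w' where w: "w \<in> factorizations P_fin_0_nat X" "length w = 2"
    and w': "w' \<in> factorizations P_fin_0_nat X" "length w' = Suc m"
    using t by (auto simp: two_types_def)
  have "w \<noteq> []" "w' \<noteq> []" using w w' by auto
  then have "2 \<in> length_set P_fin_0_nat X" "Suc m \<in> length_set P_fin_0_nat X"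
    using length_in_length_set[OF w(1)] length_in_length_set[OF w'(1)] w w' by simp_all
  moreover have "length_set P_fin_0_nat X \<subseteq> {2, Suc m}"
    using t calculation unfolding two_types_def length_set_def by (auto split: if_splits)
  ultimately show ?thesis by blast
qed

lemma system_of_lengthsI:
  "\<lbrakk>x \<in> carrier M; k \<in> length_set M x\<rbrakk> \<Longrightarrow> length_set M x \<in> system_of_lengths M"
  by (auto simp: system_of_lengths_def)

text \<open>The type parameter \<open>d + 1\<close> yields the set of lengths
  \<open>{2, d + 2}\<close>.\<close>

lemma delta_set_P_fin_0_nat: "{1..} \<subseteq> delta_set P_fin_0_nat"
proof
  fix d :: nat assume "d \<in> {1..}"
  obtain X a q where t: "two_types (Suc d) X a q" using two_types_exists[of "Suc d"] by auto
  have L: "length_set P_fin_0_nat X = {2, 2 + d}" using length_set_two_types[OF t] by simp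
  moreover have "X \<in> carrier P_fin_0_nat" using t by (simp add: two_types_def carrier_P_fin_0_nat)
  ultimately have "length_set P_fin_0_nat X \<in> system_of_lengths P_fin_0_nat"
    by (intro system_of_lengthsI[of _ _ 2]) auto
  moreover have "d \<in> delta_of (length_set P_fin_0_nat X)"
    using \<open>d \<in> {1..}\<close> by (auto simp: L delta_of_def intro!: bexI[of _ 2])
  ultimately show "d \<in> delta_set P_fin_0_nat" by (auto simp: delta_set_def)
qed

text \<open>Start from a set with lengths \<open>2\<close> and \<open>l - k + 2\<close>, and raise
  both by adding \<open>k - 2\<close> copies of the atom \<open>{0, 1}\<close>.\<close>

lemma two_lengths_exist:
  assumes "2 \<le> k" "k \<le> l"
  shows "\<exists>X\<in>carrier P_fin_0_nat. k \<in> length_set P_fin_0_nat X \<and> l \<in> length_set P_fin_0_nat X"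
proof -
  obtain X a q where t: "two_types (Suc (l - k)) X a q" using two_types_exists[of "Suc (l - k)"] by auto
  obtain w w' where w: "w \<in> factorizations P_fin_0_nat X" "length w = 2"
    and w': "w' \<in> factorizations P_fin_0_nat X" "length w' = Suc (Suc (l - k))"
    using t by (auto simp: two_types_def)
  let ?p = "replicate (k - 2) {0, 1 :: nat}"
  let ?Y = "sum_list ?p + X"
  have "?p @ v \<in> factorizations P_fin_0_nat ?Y" if "v \<in> factorizations P_fin_0_nat X" for v
    using that pair_atom[of 1] by (auto simp: factorizations_P_fin_0_nat_iff)
  then have "length (?p @ w) \<in> length_set P_fin_0_nat ?Y" "length (?p @ w') \<in> length_set P_fin_0_nat ?Y"
    using w w' by (intro length_in_length_set; force)+
  moreover have "?Y \<in> carrier P_fin_0_nat"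
  proof -
    have "finite (sum_list (replicate n {0, 1 :: nat}))" for n
      by (induction n) (auto intro: finite_set_plus)
    then show ?thesis
      using t zero_in_sum_list[of ?p] by (simp add: two_types_def carrier_P_fin_0_nat finite_set_plus zero_in_sumset)
  qed
  moreover have "length (?p @ w) = k" "length (?p @ w') = l" using assms w w' by simp_all
  ultimately show ?thesis by metis
qed

lemma union_of_lengths_P_fin_0_nat:
  assumes "k \<ge> 2" shows "{2..} \<subseteq> union_of_lengths k P_fin_0_nat"
proof
  fix l :: nat assume l: "l \<in> {2..}"
  have "\<exists>X\<in>carrier P_fin_0_nat. k \<in> length_set P_fin_0_nat X \<and> l \<in> length_set P_fin_0_nat X"
    using two_lengths_exist[of k l] two_lengths_exist[of l k] assms l by (cases "k \<le> l") auto
  then show "l \<in> union_of_lengths k P_fin_0_nat"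
    unfolding union_of_lengths_def using system_of_lengthsI[of _ P_fin_0_nat k] by blast
qed

lemma union_of_lengths_mono:
  "system_of_lengths M \<subseteq> system_of_lengths N \<Longrightarrow> union_of_lengths k M \<subseteq> union_of_lengths k N"
  by (auto simp: union_of_lengths_def)

lemma delta_set_mono: "system_of_lengths M \<subseteq> system_of_lengths N \<Longrightarrow> delta_set M \<subseteq> delta_set N"
  by (auto simp: delta_set_def)

lemma delta_set_subset: "delta_set M \<subseteq> {1..}"
  by (auto simp: delta_set_def delta_of_def)

section \<open>Linearly orderable monoids\<close>

lemma (in monoid) word_prod_append:
  "\<lbrakk>set v \<subseteq> carrier G; set w \<subseteq> carrier G\<rbrakk> \<Longrightarrow> word_prod G (v @ w) = word_prod G v \<otimes> word_prod G w"
  by (induction v) (auto simp: m_assoc word_prod_closed)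

lemma finite_linear_order_max:
  assumes "linear_order_on A r" "finite Y" "Y \<noteq> {}" "Y \<subseteq> A"
  shows "\<exists>m\<in>Y. \<forall>y\<in>Y. (y, m) \<in> r"
  using assms(2-4)
proof (induction Y rule: finite_ne_induct)
  case (singleton y)
  then show ?case using assms(1) by (auto simp: order_on_defs refl_on_def)
next
  case (insert y Y)
  then obtain m where m: "m \<in> Y" "\<forall>y\<in>Y. (y, m) \<in> r" by auto
  have ord: "refl_on A r" "trans r" "total_on A r" using assms(1) by (auto simp: order_on_defs)
  have "(y, y) \<in> r" "(m, m) \<in> r" using ord(1) insert.prems m by (auto simp: refl_on_def)
  then consider "(y, m) \<in> r" | "(m, y) \<in> r"
    using ord(3) insert.prems m unfolding total_on_def by (metis insert_subset subsetD)
  then show ?case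
  proof cases
    case 1
    then show ?thesis using m by blast
  next
    case 2
    then have "(z, y) \<in> r" if "z \<in> Y" for z using m(2) that transD[OF ord(2)] by blast
    then show ?thesis using \<open>(y, y) \<in> r\<close> by blast
  qed
qed

locale linearly_orderable_monoid = df_monoid +
  assumes linearly_orderable: "linearly_orderable G"
begin

text \<open>Left translation is injective. If \<open>x0 < x1\<close> in \<open>X\<close> and
  \<open>m\<close> is the greatest element of \<open>Y\<close>, then \<open>x1 \<otimes> m\<close>
  exceeds all \<open>x0 \<otimes> y\<close>, so \<open>X <#> Y\<close> is larger than a translate of
  \<open>Y\<close>.\<close>

lemma card_set_mult:
  assumes X: "X \<in> carrier (P_fin G)" and Y: "Y \<in> carrier (P_fin G)"
  shows "card Y \<le> card (X <#> Y)" and "card X \<ge> 2 \<Longrightarrow> card Y < card (X <#> Y)"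
proof -
  obtain r where r: "linear_order_on (carrier G) r"
    and mono: "\<And>x y z. \<lbrakk>x \<in> carrier G; y \<in> carrier G; z \<in> carrier G; (x, y) \<in> r - Id\<rbrakk> \<Longrightarrow>
        (x \<otimes> z, y \<otimes> z) \<in> r - Id \<and> (z \<otimes> x, z \<otimes> y) \<in> r - Id"
    using linearly_orderable unfolding linearly_orderable_def by blast
  have ord: "trans r" "antisym r" "total_on (carrier G) r" using r by (auto simp: order_on_defs)
  have XY: "X \<subseteq> carrier G" "finite X" "X \<noteq> {}" "Y \<subseteq> carrier G" "finite Y" "Y \<noteq> {}"
    using X Y by (auto simp: carrier_P_fin_iff)
  have fin: "finite (X <#> Y)" using XY finite_set_mult by blast
  have inj: "inj_on (\<lambda>y. x \<otimes> y) Y" if "x \<in> X" for x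
  proof (rule inj_onI, rule ccontr)
    fix y z assume yz: "y \<in> Y" "z \<in> Y" "x \<otimes> y = x \<otimes> z" "y \<noteq> z"
    then have "(y, z) \<in> r - Id \<or> (z, y) \<in> r - Id"
      using ord(3) XY by (auto simp: total_on_def)
    then show False using mono[of y z x] mono[of z y x] yz that XY by auto
  qed
  have sub: "(\<lambda>y. x \<otimes> y) ` Y \<subseteq> X <#> Y" if "x \<in> X" for x
    using that by (auto intro: set_multI)
  show "card Y \<le> card (X <#> Y)"
  proof -
    obtain x where "x \<in> X" using XY(3) by blast
    then show ?thesis using card_inj_on_le[OF inj sub fin] by blast
  qed
  show "card Y < card (X <#> Y)" if X2: "card X \<ge> 2"
  proof -
    have "\<not> card X \<le> Suc 0" using X2 by simp
    then obtain s t where "s \<in> X" "t \<in> X" "s \<noteq> t"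
      unfolding card_le_Suc0_iff_eq[OF XY(2)] by blast
    then have "(s, t) \<in> r - Id \<or> (t, s) \<in> r - Id"
      using ord(3) XY(1) by (auto simp: total_on_def)
    then obtain x0 x1 where x: "x0 \<in> X" "x1 \<in> X" "(x0, x1) \<in> r - Id"
      using \<open>s \<in> X\<close> \<open>t \<in> X\<close> by blast
    obtain m where m: "m \<in> Y" "\<forall>y\<in>Y. (y, m) \<in> r"
      using finite_linear_order_max[OF r XY(5,6,4)] by blast
    have lt: "(x0 \<otimes> m, x1 \<otimes> m) \<in> r - Id" using mono[of x0 x1 m] x m XY by blast
    have "x1 \<otimes> m \<notin> (\<lambda>y. x0 \<otimes> y) ` Y"
    proof
      assume "x1 \<otimes> m \<in> (\<lambda>y. x0 \<otimes> y) ` Y"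
      then obtain y where y: "y \<in> Y" "x1 \<otimes> m = x0 \<otimes> y" by blast
      have "y = m \<or> (x0 \<otimes> y, x0 \<otimes> m) \<in> r"
        using mono[of y m x0] m y x XY by blast
      then show False using lt y ord(2) by (auto dest: antisymD)
    qed
    moreover have "x1 \<otimes> m \<in> X <#> Y" using x m by (auto simp: mem_set_mult_iff)
    ultimately have "(\<lambda>y. x0 \<otimes> y) ` Y \<subset> X <#> Y" using sub[OF x(1)] by blast
    then have "card ((\<lambda>y. x0 \<otimes> y) ` Y) < card (X <#> Y)" using fin by (rule psubset_card_mono[rotated])
    then show ?thesis by (simp add: card_image inj[OF x(1)])
  qed
qed

text \<open>The empty product has one element, each letter with at least two elements raises the
  cardinality, and no letter lowers it.\<close>

lemma nonsingleton_letters_less: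
  assumes "set W \<subseteq> carrier (P_fin G)"
  shows "length (filter (\<lambda>A. card A \<ge> 2) W) < card (word_prod (P_fin G) W)"
  using assms
proof (induction W)
  case (Cons A W)
  interpret P: monoid "P_fin G" by (rule monoid_P_fin)
  have "word_prod (P_fin G) W \<in> carrier (P_fin G)" "A \<in> carrier (P_fin G)"
    using Cons.prems P.word_prod_closed by auto
  then show ?case
    using card_set_mult[of A "word_prod (P_fin G) W"] Cons by auto
qed simp

end

section \<open>Numbers of nonunit factors in BF-monoids\<close>

context df_monoid
begin

lemma unit_mult_atom:
  assumes "u \<in> Units G" "a \<in> atoms G"
  shows "u \<otimes> a \<in> atoms G"
proof (rule atom_class_atom_aux[OF assms(2)])
  have "u \<otimes> a = u \<otimes> a \<otimes> \<one>" using assms by (simp add: atoms_closed Units_closed)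
  then show "u \<otimes> a \<in> atom_class G a" using assms(1) Units_one_closed unfolding atom_class_def by blast
qed

text \<open>Units are collected in \<open>u\<close>. A nonunit \<open>h\<close> makes
  \<open>h \<otimes> u\<close> a nonunit, which is replaced by a nonempty word of atoms, and the
  collected unit becomes \<open>\<one>\<close> again.\<close>

lemma nonunits_refine:
  assumes "BF_monoid G" "set hs \<subseteq> carrier G"
  shows "\<exists>u\<in>Units G. \<exists>v. set v \<subseteq> atoms G \<and> word_prod G hs = u \<otimes> word_prod G v \<and>
    length (filter (\<lambda>h. h \<notin> Units G) hs) \<le> length v"
  using assms(2)
proof (induction hs)
  case Nil
  then show ?case by (intro bexI[of _ \<one>] exI[of _ "[]"]) auto
next
  case (Cons h hs)
  then obtain u v where uv: "u \<in> Units G" "set v \<subseteq> atoms G" "word_prod G hs = u \<otimes> word_prod G v"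
    "length (filter (\<lambda>h. h \<notin> Units G) hs) \<le> length v"
    by auto
  have h: "h \<in> carrier G" using Cons.prems by simp
  have v: "set v \<subseteq> carrier G" "word_prod G v \<in> carrier G"
    using uv(2) atoms_subset_carrier[of G] word_prod_closed by auto
  have prod: "word_prod G (h # hs) = (h \<otimes> u) \<otimes> word_prod G v"
    using uv h v by (simp add: m_assoc Units_closed)
  show ?case
  proof (cases "h \<in> Units G")
    case True
    then show ?thesis using uv prod by (intro bexI[of _ "h \<otimes> u"] exI[of _ v]) auto
  next
    case False
    then have "h \<otimes> u \<in> carrier G - Units G"
      using h uv Units_closed by (simp add: Units_mult_iff)
    then have "length_set G (h \<otimes> u) \<noteq> {}" "h \<otimes> u \<noteq> \<one>"
      using assms(1) by (auto simp: BF_monoid_def)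
    then have "{k. k \<ge> 1 \<and> (\<exists>v\<in>factorizations G (h \<otimes> u). length v = k)} \<noteq> {}"
      by (simp add: length_set_def)
    then obtain v' where v': "set v' \<subseteq> atoms G" "word_prod G v' = h \<otimes> u" "length v' \<ge> 1"
      by (auto simp: factorizations_def)
    have "set v' \<subseteq> carrier G" using v'(1) atoms_subset_carrier[of G] by blast
    then have "word_prod G (h # hs) = \<one> \<otimes> word_prod G (v' @ v)"
      using prod v v' word_prod_append[of v' v] word_prod_closed[of "v' @ v"] by simp
    then show ?thesis
      using uv v' False by (intro bexI[of _ \<one>] exI[of _ "v' @ v"]) auto
  qed
qed

text \<open>Absorbing \<open>u\<close> into the first atom of the refined word gives a factorization
  of \<open>y\<close> of the same length, and \<open>y\<close> has finitely many lengths.\<close>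

lemma nonunits_bounded:
  assumes "BF_monoid G" "y \<in> carrier G"
  shows "\<exists>b. \<forall>hs. set hs \<subseteq> carrier G \<longrightarrow> word_prod G hs = y \<longrightarrow>
    length (filter (\<lambda>h. h \<notin> Units G) hs) \<le> b"
proof (intro exI allI impI)
  fix hs assume hs: "set hs \<subseteq> carrier G" "word_prod G hs = y"
  obtain u v where uv: "u \<in> Units G" "set v \<subseteq> atoms G" "y = u \<otimes> word_prod G v"
    "length (filter (\<lambda>h. h \<notin> Units G) hs) \<le> length v"
    using nonunits_refine[OF assms(1) hs(1)] hs(2) by blast
  \<comment> \<open>Inserting \<open>0\<close> covers the empty word \<open>v\<close>, where
    \<open>length_set G y\<close> may be empty.\<close>
  show "length (filter (\<lambda>h. h \<notin> Units G) hs) \<le> Max (insert 0 (length_set G y))"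
  proof (cases v)
    case (Cons a v')
    then have v': "a \<in> atoms G" "a \<in> carrier G" "word_prod G v' \<in> carrier G"
      using uv(2) atoms_subset_carrier[of G] word_prod_closed[of v'] by auto
    have w: "set ((u \<otimes> a) # v') \<subseteq> atoms G" "word_prod G ((u \<otimes> a) # v') = y"
      using uv Cons v' unit_mult_atom by (auto simp: m_assoc Units_closed)
    then have "y \<notin> Units G" using word_prod_atoms_Units by blast
    then have "finite (length_set G y)" "y \<noteq> \<one>" using assms by (auto simp: BF_monoid_def)
    moreover have "length v \<in> length_set G y"
      using w Cons \<open>y \<noteq> \<one>\<close> unfolding length_set_def factorizations_def
      by (auto intro!: exI[of _ "(u \<otimes> a) # v'"])
    ultimately show ?thesis using uv(4) by (metis Max_ge finite_insert insertI2 le_trans)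
  qed (use uv in simp)
qed

lemma word_prod_pick:
  assumes "set W \<subseteq> carrier (P_fin G)"
  shows "word_prod G (map (\<lambda>A. SOME a. a \<in> A) W) \<in> word_prod (P_fin G) W"
  using assms
proof (induction W)
  case (Cons A W)
  then have "(SOME a. a \<in> A) \<in> A" by (auto simp: carrier_P_fin_iff some_in_eq)
  then show ?case using Cons by (auto intro: set_multI)
qed simp

end

text \<open>Letters with at least two elements number less than \<open>card X\<close>. A singleton
  letter consists of a nonunit, so choosing one element from each letter bounds the singletons by
  the number of nonunit factors in a product that lies in \<open>X\<close>.\<close>

lemma (in linearly_orderable_monoid) bounded_lengths_P_fin:
  assumes BF: "BF_monoid G" and X: "X \<in> carrier (P_fin G)"
  shows "\<exists>b. \<forall>W\<in>factorizations (P_fin G) X. length W \<le> b"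
proof -
  have XG: "X \<subseteq> carrier G" "finite X" using X by (auto simp: carrier_P_fin_iff)
  obtain f where f: "\<And>y hs. \<lbrakk>y \<in> X; set hs \<subseteq> carrier G; word_prod G hs = y\<rbrakk> \<Longrightarrow>
      length (filter (\<lambda>h. h \<notin> Units G) hs) \<le> f y"
    using nonunits_bounded[OF BF] XG by (metis subsetD)
  have "length W \<le> card X + Max (f ` X)" if W: "W \<in> factorizations (P_fin G) X" for W
  proof -
    let ?pick = "\<lambda>A. SOME a. a \<in> A"
    have at: "set W \<subseteq> atoms (P_fin G)" "word_prod (P_fin G) W = X"
      using W by (auto simp: factorizations_def)
    then have car: "set W \<subseteq> carrier (P_fin G)" using atoms_subset_carrier[of "P_fin G"] by blast
    have pick: "?pick A \<in> A" "?pick A \<in> carrier G" if "A \<in> set W" for A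
      using that car by (auto simp: carrier_P_fin_iff some_in_eq subset_iff)
    have nonunit: "?pick A \<notin> Units G" if "A \<in> set W" "\<not> card A \<ge> 2" for A
    proof
      assume U: "?pick A \<in> Units G"
      have "A \<in> carrier (P_fin G)" using that car by blast
      then have "card A \<noteq> 0" by (auto simp: carrier_P_fin_iff)
      then have "card A = 1" using that(2) by simp
      then have "A = {?pick A}" using pick(1)[OF that(1)] by (metis card_1_singletonE singletonD)
      then have "A \<in> Units (P_fin G)" using U by (metis Units_P_fin imageI)
      then show False using atom_not_unit[of A "P_fin G"] at that by blast
    qed
    have "length (filter (\<lambda>A. \<not> card A \<ge> 2) W) \<le> length (filter (\<lambda>A. ?pick A \<notin> Units G) W)"
      using nonunit by (induction W) auto
    also have "\<dots> = length (filter (\<lambda>h. h \<notin> Units G) (map ?pick W))"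
      by (simp add: filter_map o_def)
    also have "\<dots> \<le> f (word_prod G (map ?pick W))"
    proof (rule f)
      show "word_prod G (map ?pick W) \<in> X" using word_prod_pick[OF car] at(2) by simp
      show "set (map ?pick W) \<subseteq> carrier G" using pick(2) by auto
    qed simp
    also have "\<dots> \<le> Max (f ` X)"
      using word_prod_pick[OF car] at XG by auto
    finally show ?thesis
      using nonsingleton_letters_less[OF car] at sum_length_filter_compl[of "\<lambda>A. card A \<ge> 2" W] by simp
  qed
  then show ?thesis by blast
qed

theorem theorem4p11:
  fixes H :: "('a, 'b) monoid_scheme"
  assumes "monoid H" and "dedekind_finite H" and "non_torsion H"
  shows
    "(system_of_lengths (P_fin H) \<supseteq> system_of_lengths (P_fin_units H) \<and>
      system_of_lengths (P_fin_units H) \<supseteq> system_of_lengths P_fin_0_nat) \<and>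
     (\<forall>k\<ge>2. union_of_lengths k (P_fin H) = union_of_lengths k (P_fin_units H) \<and>
        union_of_lengths k (P_fin_units H) = union_of_lengths k P_fin_0_nat \<and>
        union_of_lengths k P_fin_0_nat = {2..}) \<and>
     (delta_set (P_fin H) = delta_set (P_fin_units H) \<and>
      delta_set (P_fin_units H) = delta_set P_fin_0_nat \<and>
      delta_set P_fin_0_nat = {1..}) \<and>
     (catenary_set (P_fin H) \<supseteq> catenary_set (P_fin_units H) \<and>
      catenary_set (P_fin_units H) \<supseteq> catenary_set P_fin_0_nat \<and>
      catenary_set P_fin_0_nat = enat ` {1..}) \<and>
     (linearly_orderable H \<and> BF_monoid H \<longrightarrow>
        catenary_set (P_fin H) = catenary_set (P_fin_units H) \<and>
        catenary_set (P_fin_units H) = catenary_set P_fin_0_nat)"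
proof -
  obtain x where "infinite_order_element H x"
    using infinite_order_element_exists[OF assms] by blast
  then interpret infinite_order_element H x .
  note L = system_of_lengths_P_fin_units_subset system_of_lengths_P_fin_0_nat_subset
  \<comment> \<open>All three sets lie between \<open>{2..}\<close> as a lower bound from
    \<open>P_fin_0_nat\<close> and \<open>{2..}\<close> as an upper bound from
    \<open>P_fin H\<close>.\<close>
  have U: "union_of_lengths k (P_fin H) = union_of_lengths k (P_fin_units H) \<and>
      union_of_lengths k (P_fin_units H) = union_of_lengths k P_fin_0_nat \<and>
      union_of_lengths k P_fin_0_nat = {2..}" if "k \<ge> 2" for k
    using union_of_lengths_mono[OF L(1), of k] union_of_lengths_mono[OF L(2), of k]
      union_of_lengths_P_fin_0_nat[OF that] P.union_of_lengths_subset[OF that] by auto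
  have D: "delta_set (P_fin H) = delta_set (P_fin_units H) \<and>
      delta_set (P_fin_units H) = delta_set P_fin_0_nat \<and> delta_set P_fin_0_nat = {1..}"
    using delta_set_mono[OF L(1)] delta_set_mono[OF L(2)] delta_set_P_fin_0_nat
      delta_set_subset[of "P_fin H"] by auto
  \<comment> \<open>The second inclusion comes from the computed value for
    \<open>P_fin_0_nat\<close>: every positive integer is realized in
    \<open>P_fin_units H\<close>.\<close>
  have C: "catenary_set (P_fin H) \<supseteq> catenary_set (P_fin_units H)"
    "catenary_set (P_fin_units H) \<supseteq> catenary_set P_fin_0_nat"
    using catenary_set_P_fin_units_subset catenary_set_P_fin_units_superset catenary_set_P_fin_0_nat
    by simp_all
  have "catenary_set (P_fin H) \<subseteq> enat ` {1..}" if "linearly_orderable H" "BF_monoid H"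
  proof -
    interpret linearly_orderable_monoid H by unfold_locales (fact that(1))
    show ?thesis
      using bounded_lengths_P_fin[OF that(2)] by (rule catenary_set_subset_of_bounded_lengths)
  qed
  then have "catenary_set (P_fin H) = catenary_set (P_fin_units H) \<and>
      catenary_set (P_fin_units H) = catenary_set P_fin_0_nat" if "linearly_orderable H" "BF_monoid H"
    using that C catenary_set_P_fin_0_nat by blast
  then show ?thesis using L U D C catenary_set_P_fin_0_nat by (intro conjI allI impI) simp_all
qed

end
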